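(* For every positive integer $n$, let $$\overline{\mathfrak{M}_1}(n)=\{(\pi,\rho)\in \mathrm{Int}(n)\times \mathrm{NC}(n)\mid d_H(\pi,\rho)=n-1\}.$$ Then $$\left|\overline{\mathfrak{M}_1}(n)\right|=\sum_{m=1}^{n}\frac1n\binom{n}{m-1}\binom{n+m-1}{n-m}.$$ Moreover, for every $m\in\{1,\ldots,n\}$, the term of this sum indexed by $m$ is precisely the number of couples $(\pi,\rho)\in\overline{\mathfrak{M}_1}(n)$ such that $|\pi|=m$.
   Context: For a positive integer $n$, a partition $\pi$ of $\{1,\ldots,n\}$ is non-crossing if there are no two distinct blocks $V,W$ of $\pi$ and numbers $a<b<c<d$ with $a,c\in V$ and $b,d\in W$. $\mathrm{NC}(n)$ is the set of non-crossing partitions of $\{1,\ldots,n\}$, partially ordered by $\pi\le\rho$ iff every block of $\pi$ is contained in a block of $\rho$. $|\pi|$ is the number of blocks of $\pi$. The Hasse diagram $\mathcal{H}_n$ is the undirected graph with vertex set $\mathrm{NC}(n)$ in which $\pi_1,\pi_2$ are joined by an edge iff one of them covers the other in $(\mathrm{NC}(n),\le)$; $d_H(\pi,\rho)$ is the graph distance (length of a shortest path) in $\mathcal{H}_n$. $\mathrm{Int}(n)\subseteq\mathrm{NC}(n)$ is the set of interval partitions: those in which every block has the form $\{i\in\mathbb{N}\mid p\le i\le q\}$ for some $p\le q$ in $\{1,\ldots,n\}$. *)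

theory Defs
  imports "HOL-Library.Disjoint_Sets" "Graph_Theory.Pair_Digraph" "Graph_Theory.Shortest_Path"
begin

text \<open>A partition of \<open>{1..n}\<close> is represented by its set of blocks.\<close>

definition NC :: "nat \<Rightarrow> nat set set set" where
  "NC n = {\<pi>. partition_on {1..n} \<pi> \<and>
     \<not> (\<exists>V\<in>\<pi>. \<exists>W\<in>\<pi>. V \<noteq> W \<and>
          (\<exists>a b c d. a < b \<and> b < c \<and> c < d \<and> a \<in> V \<and> c \<in> V \<and> b \<in> W \<and> d \<in> W))}"

definition Int_part :: "nat \<Rightarrow> nat set set set" where
  "Int_part n = {\<pi> \<in> NC n. \<forall>V\<in>\<pi>. \<exists>p\<in>{1..n}. \<exists>q\<in>{1..n}. p \<le> q \<and> V = {p..q}}"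

definition NC_less :: "nat \<Rightarrow> nat set set \<Rightarrow> nat set set \<Rightarrow> bool" where
  "NC_less n \<pi> \<rho> \<longleftrightarrow> \<pi> \<in> NC n \<and> \<rho> \<in> NC n \<and> refines {1..n} \<pi> \<rho> \<and> \<pi> \<noteq> \<rho>"

text \<open>\<open>NC_covers n \<rho> \<pi>\<close>: \<open>\<rho>\<close> covers \<open>\<pi>\<close>, so \<open>\<pi>\<close> is the finer partition.\<close>

definition NC_covers :: "nat \<Rightarrow> nat set set \<Rightarrow> nat set set \<Rightarrow> bool" where
  "NC_covers n \<rho> \<pi> \<longleftrightarrow> NC_less n \<pi> \<rho> \<and> \<not> (\<exists>\<sigma>. NC_less n \<pi> \<sigma> \<and> NC_less n \<sigma> \<rho>)"

text \<open>As usual in \<open>Graph_Theory\<close>, an undirected edge is a pair of opposite arcs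
  (see \<open>pair_graph_Hasse_NC\<close> below).\<close>

definition Hasse_NC :: "nat \<Rightarrow> nat set set pair_pre_digraph" where
  "Hasse_NC n = \<lparr> pverts = NC n,
     parcs = {(\<pi>, \<rho>) \<in> NC n \<times> NC n. NC_covers n \<rho> \<pi> \<or> NC_covers n \<pi> \<rho>} \<rparr>"

text \<open>Shortest-path distance where every arc has weight \<open>1\<close>, i.e. the minimal length of a walk.
  It would be \<open>\<infinity>\<close> for vertices in different connected components.\<close>

definition d_H :: "nat \<Rightarrow> nat set set \<Rightarrow> nat set set \<Rightarrow> ereal" where
  "d_H n \<pi> \<rho> = wf_digraph.\<mu> (with_proj (Hasse_NC n)) (\<lambda>_. 1) \<pi> \<rho>"

definition M1_bar :: "nat \<Rightarrow> (nat set set \<times> nat set set) set" where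
  "M1_bar n = {(\<pi>, \<rho>) \<in> Int_part n \<times> NC n. d_H n \<pi> \<rho> = ereal (real (n - 1))}"

lemma finite_NC: "finite (NC n)"
  by (rule finite_subset[of _ "Pow (Pow {1..n})"]) (auto simp: NC_def partition_on_def)

lemma pair_graph_Hasse_NC: "pair_graph (Hasse_NC n)"
proof
  show "finite (parcs (Hasse_NC n))"
    by (rule finite_subset[of _ "NC n \<times> NC n"]) (auto simp: Hasse_NC_def finite_NC)
qed (auto simp: Hasse_NC_def finite_NC NC_covers_def NC_less_def symmetric_def sym_def)

text \<open>Since \<open>\<mu>\<close> and \<open>awalk_cost\<close> live in the locale \<open>wf_digraph\<close>, unfolding \<open>d_H\<close>
  needs the well-formedness of the graph.\<close>

lemma d_H_eq_INF_length:
  "d_H n \<pi> \<rho> =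
    (INF p\<in>{p. pre_digraph.awalk (with_proj (Hasse_NC n)) \<pi> p \<rho>}. ereal (real (length p)))"
proof -
  interpret pair_graph "Hasse_NC n" by (rule pair_graph_Hasse_NC)
  show ?thesis
    by (simp add: d_H_def \<mu>_def awalk_cost_def sum_list_triv)
qed

end

theory Submission
  imports Defs "HOL-Computational_Algebra.Formal_Power_Series"
begin

text \<open>
  An interval partition \<open>\<pi>\<close> is given by the set \<open>D\<close> of its right block ends other than \<open>n\<close>. For
  \<open>\<rho>\<close> non-crossing, \<open>d_H n \<pi> \<rho> = n - 1\<close> holds iff the bipartite graph with the blocks of \<open>\<pi>\<close> and
  \<open>\<rho>\<close> as vertices and the points \<open>1, \<dots>, n\<close> as edges is a tree: walks through the coarsest
  partition, through the finest one, or through a two-block partition are too short otherwise,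
  and in the tree case the distance in the lattice of all partitions is already \<open>n - 1\<close>. In terms
  of the Kreweras complement of \<open>\<rho>\<close>, the tree condition says that each of its blocks contains
  exactly one element of \<open>insert n D\<close>. Removing the last point gives a recursion for the number of
  such pairs \<open>(\<rho>, D)\<close>, refined by the size \<open>k\<close> of the complement's block of \<open>n\<close>; its solution is
  \<open>k / n * (n choose d)\<close> times the coefficient of \<open>X^(n - k)\<close> in \<open>(X / (1 - X)^2)^d\<close>, where
  \<open>d = card D\<close>.
\<close>

section \<open>Non-crossing partitions\<close>

text \<open>\<open>NC n\<close> is in general not semimodular, so distances are not governed by
  joins inside it. The lower bound is saved by the fact that a cover in \<open>NC n\<close> merges
  just two blocks: every walk in the Hasse diagram is also a walk in the lattice of all partitions.
  Upper bounds need a non-crossing partition to walk through; an interval and its complement form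
  one, which is why \<open>separates\<close> tests only intervals. Connectivity of the tree,
  however, concerns arbitrary unions of blocks, and it takes the non-crossing condition on
  \<open>\<rho>\<close> to close this gap. For the count, a new last point can be attached only
  where it is visible from the right, that is at an element of the complement's block of
  \<open>n\<close>; hence the recursion does not close without the size of this block. Attaching the
  point splits the block in two, and the part split off contains no cut yet. Separation alone gives
  \<open>card D + card \<rho> \<le> n\<close>. The tree case is equality, so exactly one new cut
  must go into the part split off.\<close>

lemma partition_block_eq:
  "\<lbrakk>partition_on A \<rho>; B \<in> \<rho>; C \<in> \<rho>; x \<in> B; x \<in> C\<rbrakk> \<Longrightarrow> B = C"
  by (auto simp: partition_on_def disjoint_def)

lemma partition_ex_block: "\<lbrakk>partition_on A \<rho>; x \<in> A\<rbrakk> \<Longrightarrow> \<exists>B\<in>\<rho>. x \<in> B"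
  by (auto simp: partition_on_def)

lemma partition_block_subset: "\<lbrakk>partition_on A \<rho>; B \<in> \<rho>\<rbrakk> \<Longrightarrow> B \<subseteq> A"
  by (auto simp: partition_on_def)

lemma partition_disjoint:
  "\<lbrakk>partition_on X \<pi>; A \<in> \<pi>; B \<in> \<pi>; A \<noteq> B\<rbrakk> \<Longrightarrow> A \<inter> B = {}"
  by (auto simp: partition_on_def disjoint_def)

text \<open>Non-crossing in a positive form: one point of \<open>V\<close> between two points of
  \<open>W\<close> locates all of \<open>V\<close>, where the definition of \<open>NC\<close> only
  excludes a pattern of four points. For disjoint sets the two agree.\<close>

definition nested :: "nat set \<Rightarrow> nat set \<Rightarrow> bool" where
  "nested V W \<longleftrightarrow> (\<forall>a\<in>V. \<forall>c\<in>V. \<forall>p\<in>W. \<forall>q\<in>W. p < a \<and> a < q \<longrightarrow> p < c \<and> c < q)"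

lemma NC_iff:
  "\<pi> \<in> NC n \<longleftrightarrow> partition_on {1..n} \<pi> \<and> (\<forall>V\<in>\<pi>. \<forall>W\<in>\<pi>. V \<noteq> W \<longrightarrow> nested V W)"
proof (intro iffI conjI)
  assume L: "\<pi> \<in> NC n"
  then show p: "partition_on {1..n} \<pi>" by (simp add: NC_def)
  have nc: False if "V \<in> \<pi>" "W \<in> \<pi>" "V \<noteq> W" "a < b" "b < c" "c < d" "a \<in> V" "c \<in> V" "b \<in> W" "d \<in> W"
    for V W a b c d
  proof -
    have "\<exists>V\<in>\<pi>. \<exists>W\<in>\<pi>. V \<noteq> W \<and>
        (\<exists>a b c d. a < b \<and> b < c \<and> c < d \<and> a \<in> V \<and> c \<in> V \<and> b \<in> W \<and> d \<in> W)"
      using that(3-) by (intro bexI[OF _ that(1)] bexI[OF _ that(2)] exI conjI)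
    with L show False unfolding NC_def mem_Collect_eq by (elim conjE notE)
  qed
  show "\<forall>V\<in>\<pi>. \<forall>W\<in>\<pi>. V \<noteq> W \<longrightarrow> nested V W"
    unfolding nested_def
  proof (intro ballI impI)
    fix V W a c k l
    assume A: "V \<in> \<pi>" "W \<in> \<pi>" "V \<noteq> W" "a \<in> V" "c \<in> V" "k \<in> W" "l \<in> W" "k < a \<and> a < l"
    have "V \<inter> W = {}" using p A by (auto simp: partition_on_def disjoint_def)
    then have "c \<noteq> k" "c \<noteq> l" using A by auto
    moreover have "\<not> c < k"
      using nc[of V W c k a l] A by auto
    moreover have "\<not> l < c"
      using nc[of W V k a l c] A by auto
    ultimately show "k < c \<and> c < l" by auto
  qed
next
  assume R: "partition_on {1..n} \<pi> \<and> (\<forall>V\<in>\<pi>. \<forall>W\<in>\<pi>. V \<noteq> W \<longrightarrow> nested V W)"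
  have "\<not> (\<exists>V\<in>\<pi>. \<exists>W\<in>\<pi>. V \<noteq> W \<and>
          (\<exists>a b c d. a < b \<and> b < c \<and> c < d \<and> a \<in> V \<and> c \<in> V \<and> b \<in> W \<and> d \<in> W))"
  proof clarify
    fix V W a b c d
    assume A: "V \<in> \<pi>" "W \<in> \<pi>" "V \<noteq> W" "a < b" "b < c" "c < d" "a \<in> V" "c \<in> V" "b \<in> W" "d \<in> W"
    then have "nested V W" using R by blast
    then have "b < a" using A unfolding nested_def by blast
    then show False using A by simp
  qed
  then show "\<pi> \<in> NC n" using R by (simp add: NC_def)
qed

lemma NC_partition: "\<pi> \<in> NC n \<Longrightarrow> partition_on {1..n} \<pi>"
  by (simp add: NC_def)

lemma nestedD:
  "\<lbrakk>nested V W; a \<in> V; c \<in> V; p \<in> W; q \<in> W; p < a; a < q\<rbrakk> \<Longrightarrow> p < c \<and> c < q"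
  unfolding nested_def by blast

lemma NC_nestedD: "\<lbrakk>\<pi> \<in> NC n; V \<in> \<pi>; W \<in> \<pi>; V \<noteq> W\<rbrakk> \<Longrightarrow> nested V W"
  by (simp add: NC_iff)

text \<open>A crossing of two blocks is visible from either one, so one of the two orders suffices.\<close>

lemma nested_sym:
  assumes "nested V W" "V \<inter> W = {}"
  shows "nested W V"
  unfolding nested_def
proof (intro ballI impI)
  fix a c k l
  assume A: "a \<in> W" "c \<in> W" "k \<in> V" "l \<in> V" "k < a \<and> a < l"
  have ne: "c \<noteq> k" "c \<noteq> l" using A assms(2) by auto
  have "\<not> c < k"
  proof
    assume "c < k"
    then have "c < l \<and> l < a" using nestedD[OF assms(1), of k l c a] A by blast
    then show False using A by auto
  qed
  moreover have "\<not> l < c"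
  proof
    assume "l < c"
    then have "a < k" using nestedD[OF assms(1), of l k a c] A by blast
    then show False using A by auto
  qed
  ultimately show "k < c \<and> c < l" using ne by auto
qed

text \<open>Tested on intervals, this notion encodes the Kreweras complement, which therefore never
  has to be constructed; tested on arbitrary sets, it expresses connectivity of the graph of two
  partitions.\<close>

definition saturated :: "nat set set \<Rightarrow> nat set \<Rightarrow> bool" where
  "saturated \<rho> X \<longleftrightarrow> (\<forall>B\<in>\<rho>. B \<subseteq> X \<or> B \<inter> X = {})"

lemma saturated_empty [simp]: "saturated \<rho> {}"
  by (simp add: saturated_def)

lemma saturated_insert:
  "saturated (insert B \<rho>) X \<longleftrightarrow> (B \<subseteq> X \<or> B \<inter> X = {}) \<and> saturated \<rho> X"
  by (simp add: saturated_def)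

lemma saturated_Diff_irrelevant:
  "(\<And>B. B \<in> \<rho> \<Longrightarrow> v \<notin> B) \<Longrightarrow> saturated \<rho> (X - {v}) \<longleftrightarrow> saturated \<rho> X"
  unfolding saturated_def by (intro ball_cong refl) blast

lemma saturated_Un: "saturated \<rho> X \<Longrightarrow> saturated \<rho> Y \<Longrightarrow> saturated \<rho> (X \<union> Y)"
  unfolding saturated_def by (metis Int_Un_distrib Un_empty le_supI1 le_supI2)

lemma saturated_Diff: "saturated \<rho> X \<Longrightarrow> saturated \<rho> Y \<Longrightarrow> saturated \<rho> (X - Y)"
  unfolding saturated_def by fastforce

lemma saturated_tail_cut:
  assumes "saturated \<rho> {i<..n}" "i < j" "j \<le> n"
  shows "saturated \<rho> {i<..j} \<longleftrightarrow> saturated \<rho> {j<..n}"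
proof
  have "{j<..n} = {i<..n} - {i<..j}" "{i<..j} = {i<..n} - {j<..n}"  using assms by auto
  then show "saturated \<rho> {i<..j} \<Longrightarrow> saturated \<rho> {j<..n}" "saturated \<rho> {j<..n} \<Longrightarrow> saturated \<rho> {i<..j}"
    using saturated_Diff assms(1) by metis+
qed

lemma saturated_append:
  assumes "saturated \<rho> {i<..j}" "saturated \<rho> {j<..n}" "i \<le> j" "j \<le> n"
  shows "saturated \<rho> {i<..n}"
proof -
  have "{i<..n} = {i<..j} \<union> {j<..n}" using assms by auto
  then show ?thesis using saturated_Un assms by metis
qed

definition outer :: "nat \<Rightarrow> nat set set \<Rightarrow> nat set" where
  "outer n \<rho> = {i. i \<le> n \<and> saturated \<rho> {i<..n}}"

lemma finite_outer [simp]: "finite (outer n \<rho>)"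
  by (simp add: outer_def)

lemma outer_top [simp]: "n \<in> outer n \<rho>"
  by (simp add: outer_def)

lemma outer_0: "partition_on {1..n} \<rho> \<Longrightarrow> 0 \<in> outer n \<rho>"
  using partition_block_subset[of "{1..n}" \<rho>] by (fastforce simp: outer_def saturated_def)

text \<open>Two distinct elements \<open>i < j\<close> of \<open>{1..n}\<close> are in the same block of the Kreweras complement of
  \<open>\<rho>\<close> iff \<open>{i<..j}\<close> is saturated, so \<open>D\<close> separates if distinct elements of \<open>insert n D\<close> are in
  distinct blocks of it. Up to the index \<open>0\<close> (which stands for \<open>n\<close>), \<open>outer n \<rho>\<close> is the block of
  \<open>n\<close>.\<close>

definition separates :: "nat \<Rightarrow> nat set \<Rightarrow> nat set set \<Rightarrow> bool" where
  "separates n D \<rho> \<longleftrightarrow> (\<forall>i\<in>D. \<forall>j\<in>insert n D. i < j \<longrightarrow> \<not> saturated \<rho> {i<..j})"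

definition cut_pairs :: "nat \<Rightarrow> (nat set set \<times> nat set) set" where
  "cut_pairs n = {(\<rho>, D). \<rho> \<in> NC n \<and> D \<subseteq> {1..<n} \<and> separates n D \<rho>}"

lemma outer_Int_cuts:
  assumes "(\<rho>, D) \<in> cut_pairs n"
  shows "outer n \<rho> \<inter> D = {}"
  using assms by (fastforce simp: cut_pairs_def outer_def separates_def)

section \<open>Adding and removing the last point\<close>

definition glue :: "nat set set \<Rightarrow> nat \<Rightarrow> nat \<Rightarrow> nat set set" where
  "glue \<rho> u v = (\<lambda>B. if u \<in> B then insert v B else B) ` \<rho>"

definition drop_point :: "nat \<Rightarrow> nat set set \<Rightarrow> nat set set" where
  "drop_point v \<rho> = (\<lambda>B. B - {v}) ` \<rho> - {{}}"

lemma NC_Suc_notin: "\<rho> \<in> NC n \<Longrightarrow> B \<in> \<rho> \<Longrightarrow> Suc n \<notin> B"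
  using partition_block_subset[OF NC_partition] by fastforce

lemma NC_block_bounds: "\<rho> \<in> NC n \<Longrightarrow> B \<in> \<rho> \<Longrightarrow> x \<in> B \<Longrightarrow> 1 \<le> x \<and> x \<le> n"
  using partition_block_subset[OF NC_partition] by fastforce

lemma saturated_insert_Suc:
  assumes "\<rho> \<in> NC n"
  shows "saturated (insert {Suc n} \<rho>) X \<longleftrightarrow> saturated \<rho> (X - {Suc n})"
  unfolding saturated_insert
  using saturated_Diff_irrelevant[of \<rho> "Suc n" X] NC_Suc_notin[OF assms] by blast

lemma glue_eq:
  assumes "partition_on A \<rho>" "U \<in> \<rho>" "u \<in> U"
  shows "glue \<rho> u v = insert (insert v U) (\<rho> - {U})"
proof -
  have "u \<notin> B" if "B \<in> \<rho> - {U}" for B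
    using that partition_block_eq[OF assms(1), of B U u] assms by blast
  then have "glue (\<rho> - {U}) u v = \<rho> - {U}" unfolding glue_def by force
  moreover have "glue (insert U (\<rho> - {U})) u v = insert (insert v U) (glue (\<rho> - {U}) u v)"
    unfolding glue_def image_insert by (simp only: assms(3) if_True)
  ultimately show ?thesis using assms(2) by (simp add: insert_absorb)
qed

text \<open>Besides the old blocks, the new point only demands that \<open>X\<close> does not
  separate it from \<open>u\<close>.\<close>

lemma saturated_glue:
  assumes NC: "\<rho> \<in> NC n" and u: "u \<in> {1..n}"
  shows "Suc n \<notin> X \<Longrightarrow> saturated (glue \<rho> u (Suc n)) X \<longleftrightarrow> saturated \<rho> X \<and> u \<notin> X"
    and "Suc n \<in> X \<Longrightarrow>
       saturated (glue \<rho> u (Suc n)) X \<longleftrightarrow> saturated \<rho> (X - {Suc n}) \<and> u \<in> X"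
proof -
  obtain U where U: "U \<in> \<rho>" "u \<in> U"
    using partition_ex_block[OF NC_partition[OF NC] u] by blast
  have g: "glue \<rho> u (Suc n) = insert (insert (Suc n) U) (\<rho> - {U})"
    by (rule glue_eq[OF NC_partition[OF NC] U])
  have r: "\<rho> = insert U (\<rho> - {U})" using U by blast
  have s: "saturated \<rho> Y \<longleftrightarrow> (U \<subseteq> Y \<or> U \<inter> Y = {}) \<and> saturated (\<rho> - {U}) Y" for Y
    by (subst r) (rule saturated_insert)
  have n: "Suc n \<notin> U" using NC_Suc_notin[OF NC U(1)] .
  have d: "saturated (\<rho> - {U}) (X - {Suc n}) \<longleftrightarrow> saturated (\<rho> - {U}) X"
    using NC_Suc_notin[OF NC] by (intro saturated_Diff_irrelevant) auto
  show "saturated (glue \<rho> u (Suc n)) X \<longleftrightarrow> saturated \<rho> X \<and> u \<notin> X" if "Suc n \<notin> X"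
    unfolding g s saturated_insert using that U(2) by blast
  show "saturated (glue \<rho> u (Suc n)) X \<longleftrightarrow> saturated \<rho> (X - {Suc n}) \<and> u \<in> X" if "Suc n \<in> X"
    unfolding g s saturated_insert d using that U(2) n by blast
qed

lemma NC_insert_Suc:
  assumes "\<rho> \<in> NC n"
  shows "insert {Suc n} \<rho> \<in> NC (Suc n)"
proof -
  have p: "partition_on {1..n} \<rho>" by (rule NC_partition[OF assms])
  have U: "\<Union>\<rho> = {1..n}" using p by (simp add: partition_on_def)
  have p': "partition_on {1..Suc n} (insert {Suc n} \<rho>)"
    using p by (subst partition_on_insert) (auto simp: U disjnt_def atLeastAtMostSuc_conv)
  moreover have "nested V W" if "V \<in> insert {Suc n} \<rho>" "W \<in> insert {Suc n} \<rho>" "V \<noteq> W" for V W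
    using that NC_nestedD[OF assms, of V W] NC_block_bounds[OF assms, of W]
    by (fastforce simp: nested_def)
  ultimately show ?thesis by (simp add: NC_iff)
qed

text \<open>As \<open>{u<..n}\<close> is saturated, no block leads from beyond \<open>u\<close> back
  to \<open>u\<close> or below, so the arc from \<open>u\<close> to the new point crosses
  nothing.\<close>

lemma NC_glue:
  assumes "\<rho> \<in> NC n" "u \<in> outer n \<rho>" "u \<ge> 1"
  shows "glue \<rho> u (Suc n) \<in> NC (Suc n)"
proof -
  have p: "partition_on {1..n} \<rho>" by (rule NC_partition[OF assms(1)])
  have un: "u \<in> {1..n}" using assms by (auto simp: outer_def)
  then obtain U where U: "U \<in> \<rho>" "u \<in> U" using partition_ex_block[OF p] by blast
  have sat: "saturated \<rho> {u<..n}" using assms by (simp add: outer_def)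
  have g: "glue \<rho> u (Suc n) = insert (insert (Suc n) U) (\<rho> - {U})"
    by (rule glue_eq[OF p U])
  have p': "partition_on {1..Suc n} (glue \<rho> u (Suc n))"
  proof (rule partition_onI)
    show "\<Union> (glue \<rho> u (Suc n)) = {1..Suc n}"
      using p U unfolding g partition_on_def by (auto simp: atLeastAtMostSuc_conv)
    show "{} \<notin> glue \<rho> u (Suc n)" using p unfolding g partition_on_def by auto
    show "disjnt k l" if "k \<in> glue \<rho> u (Suc n)" "l \<in> glue \<rho> u (Suc n)" "k \<noteq> l" for k l
    proof -
      have "disjnt B C" if "B \<in> \<rho>" "C \<in> \<rho>" "B \<noteq> C" for B C
        using that partition_onD2[OF p] by (auto simp: disjoint_def disjnt_def)
      moreover have "disjnt (insert (Suc n) U) B \<longleftrightarrow> disjnt U B"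
          "disjnt B (insert (Suc n) U) \<longleftrightarrow> disjnt B U" if "B \<in> \<rho>" for B
        using NC_Suc_notin[OF assms(1) that] by simp_all
      ultimately show ?thesis using that U(1) unfolding g by (elim insertE) auto
    qed
  qed
  have key: "nested W (insert (Suc n) U)" if W: "W \<in> \<rho>" "W \<noteq> U" for W
    unfolding nested_def
  proof (intro ballI impI)
    fix a c k l
    assume A: "a \<in> W" "c \<in> W" "k \<in> insert (Suc n) U" "l \<in> insert (Suc n) U" "k < a \<and> a < l"
    have nW: "nested W U" by (rule NC_nestedD[OF assms(1) W(1) U(1) W(2)])
    have an: "a \<le> n" "c \<le> n" using NC_block_bounds[OF assms(1) W(1)] A by auto
    then have k: "k \<in> U" using A by auto
    have ane: "a \<noteq> u" using W U partition_block_eq[OF p] A by blast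
    show "k < c \<and> c < l"
    proof (cases "l = Suc n")
      case False
      then show ?thesis using A nestedD[OF nW, of a c k l] k by blast
    next
      \<comment> \<open>The arc ends at the new point. If \<open>a < u\<close>, its end can be
        replaced by \<open>u\<close>. If \<open>a > u\<close>, the saturated set
        \<open>{u<..n}\<close> contains all of \<open>W\<close>, while it misses \<open>u\<close>
        and hence all of \<open>U\<close>, so that \<open>k \<le> u\<close>.\<close>
      case True
      show ?thesis
      proof (cases "a < u")
        case True
        then show ?thesis using A nestedD[OF nW, of a c k u] k U an \<open>l = Suc n\<close> by auto
      next
        case False
        then have "a \<in> {u<..n}" using ane an by auto
        then have "W \<subseteq> {u<..n}" using sat W A unfolding saturated_def by blast
        then have "u < c" using A by auto
        moreover have "k \<le> u"
        proof (rule ccontr)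
          assume "\<not> k \<le> u"
          then have "k \<in> {u<..n}" using NC_block_bounds[OF assms(1) U(1) k] by simp
          then have "U \<subseteq> {u<..n}" using sat U k unfolding saturated_def by blast
          then show False using U by auto
        qed
        ultimately show ?thesis using True an by auto
      qed
    qed
  qed
  have "nested V W" if VW: "V \<in> glue \<rho> u (Suc n)" "W \<in> glue \<rho> u (Suc n)" "V \<noteq> W" for V W
  proof -
    have dj: "V \<inter> W = {}" using p' VW by (auto simp: partition_on_def disjoint_def)
    consider "V \<in> \<rho>" "W \<in> \<rho>" | "V \<in> \<rho>" "V \<noteq> U" "W = insert (Suc n) U"
      | "W \<in> \<rho>" "W \<noteq> U" "V = insert (Suc n) U"
      using VW unfolding g by blast
    then show ?thesis
    proof cases
      case 1
      then show ?thesis using NC_nestedD assms(1) VW by blast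
    next
      case 2
      then show ?thesis using key by blast
    next
      case 3
      then show ?thesis using nested_sym[OF key[OF 3(1,2)]] dj by auto
    qed
  qed
  then show ?thesis using p' by (simp add: NC_iff)
qed

lemma NC_drop_point:
  assumes "\<rho> \<in> NC (Suc n)"
  shows "drop_point (Suc n) \<rho> \<in> NC n"
proof -
  have "partition_on ({1..n} \<inter> {1..Suc n}) ((\<inter>) {1..n} ` \<rho> - {{}})"
    by (rule partition_on_restrict[OF NC_partition[OF assms]])
  moreover have "(\<inter>) {1..n} ` \<rho> = (\<lambda>B. B - {Suc n}) ` \<rho>"
    using NC_block_bounds[OF assms] by (intro image_cong refl) fastforce
  ultimately have "partition_on {1..n} (drop_point (Suc n) \<rho>)"
    by (simp add: drop_point_def Int_absorb2)
  moreover have "nested V W" if "V \<in> drop_point (Suc n) \<rho>" "W \<in> drop_point (Suc n) \<rho>" "V \<noteq> W" for V W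
  proof -
    obtain V' W' where V': "V' \<in> \<rho>" "V = V' - {Suc n}" "W' \<in> \<rho>" "W = W' - {Suc n}"
      using \<open>V \<in> _\<close> \<open>W \<in> _\<close> unfolding drop_point_def by auto
    then have "V' \<noteq> W'" using that by auto
    then have "nested V' W'" using NC_nestedD[OF assms] V' by blast
    then show ?thesis using V' by (auto simp: nested_def)
  qed
  ultimately show ?thesis by (simp add: NC_iff)
qed

lemma drop_point_insert:
  assumes "\<rho> \<in> NC n"
  shows "drop_point (Suc n) (insert {Suc n} \<rho>) = \<rho>"
proof -
  have "(\<lambda>B. B - {Suc n}) ` \<rho> = (\<lambda>B. B) ` \<rho>"
    using NC_Suc_notin[OF assms] by (intro image_cong refl) auto
  then show ?thesis unfolding drop_point_def using partition_onD3[OF NC_partition[OF assms]] by auto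
qed

lemma drop_point_glue:
  assumes "\<rho> \<in> NC n"
  shows "drop_point (Suc n) (glue \<rho> u (Suc n)) = \<rho>"
proof -
  have "(\<lambda>B. B - {Suc n}) ` glue \<rho> u (Suc n) = (\<lambda>B. B) ` \<rho>"
    unfolding glue_def image_image using NC_Suc_notin[OF assms] by (intro image_cong refl) auto
  then show ?thesis unfolding drop_point_def using partition_onD3[OF NC_partition[OF assms]] by auto
qed

lemma card_glue:
  assumes "\<rho> \<in> NC n"
  shows "card (glue \<rho> u (Suc n)) = card \<rho>"
  unfolding glue_def
proof (rule card_image, rule inj_onI)
  fix B C assume "B \<in> \<rho>" "C \<in> \<rho>"
    and eq: "(if u \<in> B then insert (Suc n) B else B) = (if u \<in> C then insert (Suc n) C else C)"
  then have "Suc n \<notin> B" "Suc n \<notin> C" using NC_Suc_notin[OF assms] by auto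
  then show "B = C" using eq by (cases "u \<in> B"; cases "u \<in> C") (auto simp: insert_ident)
qed

lemma finite_NC_elem: "\<rho> \<in> NC n \<Longrightarrow> finite \<rho>"
  using finite_elements[OF _ NC_partition] by blast

lemma card_insert_Suc: "\<rho> \<in> NC n \<Longrightarrow> card (insert {Suc n} \<rho>) = Suc (card \<rho>)"
  using NC_Suc_notin[of \<rho> n "{Suc n}"] finite_NC_elem[of \<rho> n]
  by (metis card_insert_disjoint insertI1)

lemma outer_insert_Suc:
  assumes "\<rho> \<in> NC n"
  shows "outer (Suc n) (insert {Suc n} \<rho>) = insert (Suc n) (outer n \<rho>)"
proof -
  have *: "{i<..Suc n} - {Suc n} = {i<..n}" for i by auto
  show ?thesis unfolding outer_def saturated_insert_Suc[OF assms] * by (auto simp: le_Suc_eq)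
qed

text \<open>An interval ending at \<open>Suc n\<close> is now saturated only if it also contains
  \<open>u\<close>, that is, starts below \<open>u\<close>. So the complement's block of the last
  point keeps its elements below \<open>u\<close> and gains the new top, whereas a singleton last
  point lets the whole block grow by one.\<close>

lemma outer_glue:
  assumes "\<rho> \<in> NC n" "u \<in> outer n \<rho>" "u \<ge> 1"
  shows "outer (Suc n) (glue \<rho> u (Suc n)) = insert (Suc n) {i \<in> outer n \<rho>. i < u}"
proof -
  have *: "{i<..Suc n} - {Suc n} = {i<..n}" for i by auto
  have un: "u \<in> {1..n}" using assms by (auto simp: outer_def)
  show ?thesis
  proof (rule set_eqI)
    fix i
    show "i \<in> outer (Suc n) (glue \<rho> u (Suc n)) \<longleftrightarrow> i \<in> insert (Suc n) {i \<in> outer n \<rho>. i < u}"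
    proof (cases "i \<le> n")
      case True
      then show ?thesis
        using saturated_glue(2)[OF assms(1) un, of "{i<..Suc n}"] un
        by (auto simp: outer_def *)
    qed (auto simp: outer_def)
  qed
qed

lemma cut_pairs_insert:
  assumes "\<rho> \<in> NC n"
  shows "(insert {Suc n} \<rho>, D) \<in> cut_pairs (Suc n) \<longleftrightarrow> (\<rho>, D) \<in> cut_pairs n"
proof -
  have *: "{i<..Suc n} - {Suc n} = {i<..n}" for i by auto
  have **: "{i<..j} - {Suc n} = {i<..j}" if "j \<le> n" for i j using that by auto
  have sub: "D \<subseteq> {1..<n}" if "D \<subseteq> {1..<Suc n}" "separates (Suc n) D (insert {Suc n} \<rho>)"
  proof -
    \<comment> \<open>The interval \<open>{n<..Suc n}\<close> is the singleton block itself: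
      \<open>n\<close> and \<open>Suc n\<close> share a block of the complement, so no cut fits at
      \<open>n\<close>.\<close>
    have "n \<notin> D" using that * saturated_insert_Suc[OF assms, of "{n<..Suc n}"]
      by (auto simp: separates_def)
    then show ?thesis using that less_Suc_eq by fastforce
  qed
  have "separates (Suc n) D (insert {Suc n} \<rho>) \<longleftrightarrow> separates n D \<rho>" if D: "D \<subseteq> {1..<n}"
  proof -
    have "saturated (insert {Suc n} \<rho>) {i<..j} \<longleftrightarrow> saturated \<rho> {i<..j}" if "j \<in> D" for i j
      using that D saturated_insert_Suc[OF assms, of "{i<..j}"] **[of j i] by fastforce
    moreover have "saturated (insert {Suc n} \<rho>) {i<..Suc n} \<longleftrightarrow> saturated \<rho> {i<..n}" for i
      using saturated_insert_Suc[OF assms, of "{i<..Suc n}"] by (simp add: *)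
    moreover have "i < n \<and> i < Suc n" if "i \<in> D" for i using D that by auto
    ultimately show ?thesis
      unfolding separates_def by blast
  qed
  then show ?thesis using assms sub NC_insert_Suc[OF assms]
    by (auto simp: cut_pairs_def)
qed

text \<open>The outer positions from \<open>u\<close> on leave the block of the last point. They
  contain no cut, since a cut there was not separated from \<open>n\<close>; so there is room for
  one new cut \<open>e\<close> among them.\<close>

lemma cut_pairs_glue:
  assumes cp: "(\<rho>, D) \<in> cut_pairs n" and u: "u \<in> outer n \<rho>" "u \<ge> 1" and e: "e \<in> outer n \<rho>" "u \<le> e"
  shows "(glue \<rho> u (Suc n), insert e D) \<in> cut_pairs (Suc n)"
proof -
  have NC: "\<rho> \<in> NC n" and D: "D \<subseteq> {1..<n}" and sep: "separates n D \<rho>"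
    using cp by (auto simp: cut_pairs_def)
  have un: "u \<in> {1..n}" and en: "e \<le> n" using u e by (auto simp: outer_def)
  have se: "saturated \<rho> {e<..n}" using e by (simp add: outer_def)
  have sat1: "saturated \<rho> {i<..j}" "u \<notin> {i<..j}" if "saturated (glue \<rho> u (Suc n)) {i<..j}" "j \<le> n" for i j
    using saturated_glue(1)[OF NC un, of "{i<..j}"] that by auto
  have *: "{i<..Suc n} - {Suc n} = {i<..n}" for i by auto
  have sat2: "saturated \<rho> {i<..n}" "u \<in> {i<..n}" if "saturated (glue \<rho> u (Suc n)) {i<..Suc n}" "i \<le> n" for i
    using saturated_glue(2)[OF NC un, of "{i<..Suc n}"] that un by (auto simp: *)
  have "separates (Suc n) (insert e D) (glue \<rho> u (Suc n))"
    unfolding separates_def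
  proof (intro ballI impI notI)
    fix i j
    assume i: "i \<in> insert e D" and j: "j \<in> insert (Suc n) (insert e D)" and ij: "i < j"
      and S: "saturated (glue \<rho> u (Suc n)) {i<..j}"
    have i_le: "i \<le> n" using i D en by fastforce
    show False
    proof (cases "j = Suc n")
      case True
      then have "saturated \<rho> {i<..n}" "i < u" using sat2[of i] S i_le by auto
      then show False using i e sep D by (auto simp: separates_def)
    next
      case False
      then have jn: "j \<le> n" using j D en by fastforce
      have S': "saturated \<rho> {i<..j}" using sat1(1)[OF S jn] .
      \<comment> \<open>If one end is \<open>e\<close>, the saturated tail \<open>{e<..n}\<close> is
        appended or subtracted: the other end, an old cut, would then share the complement's block
        of \<open>n\<close>.\<close>
      consider "i \<in> D" "j \<in> D" | "i \<in> D" "j = e" | "i = e" "j \<in> D" using i j ij False by blast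
      then show False
      proof cases
        case 1
        then show False using S' sep ij by (auto simp: separates_def)
      next
        case 2
        then have "saturated \<rho> {i<..n}" using saturated_append[OF S', of n] se jn ij by auto
        then show False using 2 sep D by (auto simp: separates_def)
      next
        case 3
        then have "saturated \<rho> {j<..n}" using saturated_tail_cut[of \<rho> i n j] S' se ij jn by auto
        then show False using 3 sep D by (auto simp: separates_def)
      qed
    qed
  qed
  moreover have "insert e D \<subseteq> {1..<Suc n}" using D en e u by auto
  ultimately show ?thesis using NC_glue[OF NC u] by (auto simp: cut_pairs_def)
qed

text \<open>If the last point is not a singleton, it is attached to the largest other element
  \<open>u\<close> of its block. A block reaching into \<open>{u<..n}\<close> then lies under the
  arc from \<open>u\<close> to \<open>Suc n\<close>, hence entirely in that set, so \<open>u\<close>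
  is outer.\<close>

lemma NC_Suc_cases:
  assumes NC: "\<rho> \<in> NC (Suc n)"
  obtains "{Suc n} \<in> \<rho>" "\<rho> = insert {Suc n} (drop_point (Suc n) \<rho>)"
  | u where "{Suc n} \<notin> \<rho>" "u \<ge> 1" "u \<in> outer n (drop_point (Suc n) \<rho>)"
      "\<rho> = glue (drop_point (Suc n) \<rho>) u (Suc n)"
proof -
  define \<rho>' where "\<rho>' = drop_point (Suc n) \<rho>"
  have p: "partition_on {1..Suc n} \<rho>" by (rule NC_partition[OF NC])
  have NC': "\<rho>' \<in> NC n" unfolding \<rho>'_def by (rule NC_drop_point[OF NC])
  obtain U where U: "U \<in> \<rho>" "Suc n \<in> U" using partition_ex_block[OF p, of "Suc n"] by auto
  have oth: "B - {Suc n} = B" if "B \<in> \<rho>" "B \<noteq> U" for B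
    using that partition_block_eq[OF p] U by blast
  have ne: "{} \<notin> \<rho>" using p by (simp add: partition_on_def)
  have "(\<lambda>B. B - {Suc n}) ` \<rho> = insert (U - {Suc n}) ((\<lambda>B. B - {Suc n}) ` (\<rho> - {U}))"
    using U by blast
  also have "(\<lambda>B. B - {Suc n}) ` (\<rho> - {U}) = \<rho> - {U}"
    using oth by force
  finally have rho': "\<rho>' = insert (U - {Suc n}) (\<rho> - {U}) - {{}}"
    unfolding \<rho>'_def drop_point_def by simp
  show thesis
  proof (cases "U = {Suc n}")
    case True
    then have "\<rho>' = \<rho> - {U}" using rho' ne by auto
    then have "\<rho> = insert {Suc n} \<rho>'" using True U by auto
    then show ?thesis using that(1) U True unfolding \<rho>'_def by blast
  next
    case False
    define u where "u = Max (U - {Suc n})"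
    have fin: "finite (U - {Suc n})" using partition_block_subset[OF p U(1)] finite_subset by blast
    have neU: "U - {Suc n} \<noteq> {}" using False U by auto
    have u: "u \<in> U" "u \<noteq> Suc n" using Max_in[OF fin neU] unfolding u_def by auto
    have umax: "x \<le> u" if "x \<in> U" "x \<noteq> Suc n" for x
      unfolding u_def using fin that by auto
    have ub: "1 \<le> u" "u \<le> n" using NC_block_bounds[OF NC U(1) u(1)] u by auto
    have rho'': "\<rho>' = insert (U - {Suc n}) (\<rho> - {U})" using rho' ne neU by auto
    have Uin: "U - {Suc n} \<in> \<rho>'" "u \<in> U - {Suc n}" using rho'' u by auto
    have notin: "U - {Suc n} \<notin> \<rho> - {U}"
      using Uin(2) U partition_block_eq[OF p, of U _ u] by blast
    have "glue \<rho>' u (Suc n) = insert (insert (Suc n) (U - {Suc n})) (\<rho>' - {U - {Suc n}})"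
      by (rule glue_eq[OF NC_partition[OF NC'] Uin])
    also have "\<dots> = \<rho>" using rho'' notin U by (auto simp: insert_absorb)
    finally have gl: "\<rho> = glue \<rho>' u (Suc n)" ..
    have "saturated \<rho>' {u<..n}" unfolding saturated_def
    proof (rule ballI, rule ccontr)
      fix B assume B: "B \<in> \<rho>'" and "\<not> (B \<subseteq> {u<..n} \<or> B \<inter> {u<..n} = {})"
      then obtain x y where xy: "x \<in> B" "y \<in> B" "u < x" "x \<le> n" "y \<notin> {u<..n}"
        by (metis disjoint_iff greaterThanAtMost_iff subsetI)
      have "B \<noteq> U - {Suc n}" using umax[of x] xy by auto
      then have BU: "B \<in> \<rho>" "B \<noteq> U" using B rho'' by auto
      have "nested B U" by (rule NC_nestedD[OF NC BU(1) U(1) BU(2)])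
      then have "u < y \<and> y < Suc n" using nestedD[of B U x y u "Suc n"] xy u U by auto
      then show False using xy by auto
    qed
    then have "u \<in> outer n \<rho>'" using ub by (simp add: outer_def)
    moreover have "{Suc n} \<notin> \<rho>" using False U partition_block_eq[OF p] by blast
    ultimately show ?thesis using that(2) ub gl unfolding \<rho>'_def by blast
  qed
qed

text \<open>The cuts lost when the last point is removed are the outer positions from \<open>u\<close> on, which
  together form one block of the Kreweras complement of the glued partition.\<close>

lemma cut_pairs_unglue:
  assumes NC: "\<rho> \<in> NC n" and u: "u \<in> outer n \<rho>" "u \<ge> 1"
    and cp: "(glue \<rho> u (Suc n), D) \<in> cut_pairs (Suc n)"
  defines "E \<equiv> {i \<in> outer n \<rho>. u \<le> i}"
  shows "(\<rho>, D - E) \<in> cut_pairs n" and "card (D \<inter> E) \<le> 1"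
proof -
  have D: "D \<subseteq> {1..<Suc n}" and sep: "separates (Suc n) D (glue \<rho> u (Suc n))"
    using cp by (auto simp: cut_pairs_def)
  have un: "u \<in> {1..n}" using u by (auto simp: outer_def)
  have *: "{i<..Suc n} - {Suc n} = {i<..n}" for i by auto
  have sat1: "saturated (glue \<rho> u (Suc n)) {i<..j}" if "saturated \<rho> {i<..j}" "u \<notin> {i<..j}" "j \<le> n" for i j
    using saturated_glue(1)[OF NC un, of "{i<..j}"] that by auto
  have sat2: "saturated (glue \<rho> u (Suc n)) {i<..Suc n}" if "saturated \<rho> {i<..n}" "i < u" for i
    using saturated_glue(2)[OF NC un, of "{i<..Suc n}"] that un by (auto simp: *)
  have "n \<in> E" unfolding E_def using un by auto
  then have D': "D - E \<subseteq> {1..<n}" using D by (force simp: less_Suc_eq)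
  have "separates n (D - E) \<rho>"
    unfolding separates_def
  proof (intro ballI impI notI)
    fix i j
    assume i: "i \<in> D - E" and j: "j \<in> insert n (D - E)" and ij: "i < j" and S: "saturated \<rho> {i<..j}"
    have jn: "j \<le> n" using j D' by fastforce
    show False
    proof (cases "u \<in> {i<..j}")
      case False
      note S' = sat1[OF S False jn]
      show False
      proof (cases "j = n")
        case True
        then have "i \<in> E" using S ij False un unfolding E_def outer_def by auto
        then show False using i by auto
      next
        case False
        then show False using S' sep i j ij unfolding separates_def by blast
      qed
    next
      case True
      have uS: "saturated \<rho> {u<..n}" using u by (simp add: outer_def)
      show False
      proof (cases "j = n")
        case True
        then show False using sat2[of i] S \<open>u \<in> {i<..j}\<close> sep i ij unfolding separates_def by auto
      next
        case False
        \<comment> \<open>As \<open>i < u \<le> j\<close>, the two saturated sets differ in the tail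
          beyond \<open>j\<close>, which makes \<open>j\<close> an outer position and so an element
          of \<open>E\<close>.\<close>
        have "{j<..n} = {u<..n} - {i<..j}" using True jn by auto
        then have "saturated \<rho> {j<..n}" using saturated_Diff[OF uS S] by simp
        then have "j \<in> E" using jn True unfolding E_def outer_def by auto
        then show False using j False by auto
      qed
    qed
  qed
  then show "(\<rho>, D - E) \<in> cut_pairs n" using NC D' by (simp add: cut_pairs_def)
  have False if ij: "i \<in> D \<inter> E" "j \<in> D \<inter> E" "i < j" for i j
  proof -
    have "j \<le> n" "saturated \<rho> {i<..n}" "saturated \<rho> {j<..n}" "u \<notin> {i<..j}"
      using ij by (auto simp: E_def outer_def)
    then have "saturated (glue \<rho> u (Suc n)) {i<..j}"
      using sat1 saturated_tail_cut ij(3) by blast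
    then show False using sep ij unfolding separates_def by blast
  qed
  then have "\<forall>i\<in>D \<inter> E. \<forall>j\<in>D \<inter> E. i = j" by (metis nat_neq_iff)
  moreover have "finite (D \<inter> E)" using D finite_subset by blast
  ultimately show "card (D \<inter> E) \<le> 1" by (simp add: card_le_Suc0_iff_eq)
qed

text \<open>Each added point brings a new block and no new cut, or no new block and at most one new
  cut.\<close>

lemma cut_pairs_card_le: "(\<rho>, D) \<in> cut_pairs n \<Longrightarrow> card D + card \<rho> \<le> n"
proof (induction n arbitrary: \<rho> D)
  case 0
  then show ?case by (auto simp: cut_pairs_def NC_def partition_on_empty)
next
  case (Suc n)
  then have NC: "\<rho> \<in> NC (Suc n)" by (simp add: cut_pairs_def)
  define \<rho>' where "\<rho>' = drop_point (Suc n) \<rho>"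
  have NC': "\<rho>' \<in> NC n" using NC_drop_point[OF NC] by (simp add: \<rho>'_def)
  have finD: "finite D" using Suc.prems finite_subset by (fastforce simp: cut_pairs_def)
  from NC show ?case
  proof (cases rule: NC_Suc_cases)
    case 1
    then have r: "\<rho> = insert {Suc n} \<rho>'" by (simp add: \<rho>'_def)
    then have "card D + card \<rho>' \<le> n" using Suc cut_pairs_insert[OF NC'] by simp
    then show ?thesis unfolding r using card_insert_Suc[OF NC'] by simp
  next
    case (2 u)
    then have u: "u \<in> outer n \<rho>'" "u \<ge> 1" and r: "\<rho> = glue \<rho>' u (Suc n)" by (simp_all add: \<rho>'_def)
    let ?E = "{i \<in> outer n \<rho>'. u \<le> i}"
    have "(\<rho>', D - ?E) \<in> cut_pairs n" "card (D \<inter> ?E) \<le> 1"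
      using cut_pairs_unglue[OF NC' u] Suc.prems r by auto
    then have "card (D - ?E) + card \<rho>' \<le> n" "card (D \<inter> ?E) \<le> 1" using Suc.IH by auto
    moreover have "card D = card (D - ?E) + card (D \<inter> ?E)"
      using card_Int_Diff[OF finD, of ?E] by simp
    ultimately show ?thesis using r card_glue[OF NC'] by simp
  qed
qed

section \<open>Counting pairs by removing the last point\<close>

text \<open>This counts the choices in a gluing step. Exactly one \<open>u\<close> has rank
  \<open>k\<close> if \<open>k < card S\<close>, and \<open>card S - k\<close> elements
  \<open>e\<close> lie at or above it; for larger \<open>k\<close>, truncated subtraction gives the
  right value \<open>0\<close>.\<close>

lemma card_pairs_rank:
  fixes S :: "nat set"
  assumes fin: "finite S"
  shows "card {(u, e). u \<in> S \<and> e \<in> S \<and> u \<le> e \<and> card {i \<in> S. i < u} = k} = card S - k"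
proof -
  define r where "r u = card {i \<in> S. i < u}" for u
  have mono: "r u < r v" if "u \<in> S" "u < v" for u v
    unfolding r_def using that fin by (intro psubset_card_mono) auto
  have inj: "inj_on r S" by (rule inj_onI) (metis mono nat_neq_iff)
  have "r u < card S" if "u \<in> S" for u
    unfolding r_def using that fin by (intro psubset_card_mono) auto
  then have "r ` S \<subseteq> {..<card S}" by auto
  then have img: "r ` S = {..<card S}" by (intro card_subset_eq) (auto simp: card_image inj)
  have r: "{(u, e). u \<in> S \<and> e \<in> S \<and> u \<le> e \<and> card {i \<in> S. i < u} = k}
      = (SIGMA u:{u \<in> S. r u = k}. {e \<in> S. u \<le> e})"
    by (auto simp: r_def)
  show ?thesis
  proof (cases "k < card S")
    case True
    then obtain u where u: "u \<in> S" "r u = k" using img by (metis imageE lessThan_iff)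
    have "{v \<in> S. r v = k} = {u}" using u inj by (auto simp: inj_on_def)
    moreover have "card {e \<in> S. u \<le> e} = card S - k"
    proof -
      have "{e \<in> S. u \<le> e} = S - {i \<in> S. i < u}" by auto
      then show ?thesis using fin u(2) by (simp add: card_Diff_subset r_def)
    qed
    ultimately show ?thesis unfolding r by (simp add: card_SigmaI fin)
  next
    case False
    then have "{u \<in> S. r u = k} = {}" using img by fastforce
    then have empty: "{(u, e). u \<in> S \<and> e \<in> S \<and> u \<le> e \<and> card {i \<in> S. i < u} = k} = {}"
      unfolding r by blast
    show ?thesis unfolding empty using False by simp
  qed
qed

text \<open>It is \<open>Suc k\<close> because \<open>outer n \<rho>\<close> also contains the index
  \<open>0\<close>: for \<open>n > 0\<close>, \<open>k\<close> itself is the size of the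
  complement's block of \<open>n\<close>.\<close>

definition tight_pairs :: "nat \<Rightarrow> nat \<Rightarrow> nat \<Rightarrow> (nat set set \<times> nat set) set" where
  "tight_pairs n d k =
     {(\<rho>, D) \<in> cut_pairs n. card D = d \<and> card \<rho> + d = n \<and> card (outer n \<rho>) = Suc k}"

lemma finite_cut_pairs: "finite (cut_pairs n)"
  by (rule finite_subset[of _ "NC n \<times> Pow {1..<n}"]) (auto simp: cut_pairs_def finite_NC)

lemma finite_tight_pairs: "finite (tight_pairs n d k)"
  by (rule finite_subset[OF _ finite_cut_pairs[of n]]) (auto simp: tight_pairs_def)

lemma card_outer_bounds:
  assumes "\<rho> \<in> NC n"
  shows "card (outer n \<rho>) \<le> Suc n" and "n > 0 \<Longrightarrow> card (outer n \<rho>) \<ge> 2"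
proof -
  have "outer n \<rho> \<subseteq> {..n}" by (auto simp: outer_def)
  then have "card (outer n \<rho>) \<le> card {..n}" by (rule card_mono[rotated]) simp
  then show "card (outer n \<rho>) \<le> Suc n" by simp
  assume "n > 0"
  then have "card {0, n} = 2" by simp
  moreover have "card {0, n} \<le> card (outer n \<rho>)"
    using outer_0[OF NC_partition[OF assms]] by (intro card_mono) auto
  ultimately show "card (outer n \<rho>) \<ge> 2" by simp
qed

lemma NC_0: "NC 0 = {{}}"
  by (auto simp: NC_def partition_on_empty)

lemma card_tight_pairs_0: "card (tight_pairs 0 d k) = (if d = 0 \<and> k = 0 then 1 else 0)"
proof -
  have cp: "cut_pairs 0 = {({}, {})}"
    by (auto simp: cut_pairs_def NC_0 separates_def)
  have out: "outer 0 {} = {0}" by (auto simp: outer_def)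
  have "tight_pairs 0 d k = (if d = 0 \<and> k = 0 then {({}, {})} else {})"
    unfolding tight_pairs_def cp by (auto simp: out)
  then show ?thesis by simp
qed

lemma tight_pairs_Suc_0: "tight_pairs (Suc n) d 0 = {}"
  using card_outer_bounds(2)[of _ "Suc n"] by (fastforce simp: tight_pairs_def cut_pairs_def)

lemma card_tight_pairs_singleton:
  "card {(\<rho>, D) \<in> tight_pairs (Suc n) d (Suc k). {Suc n} \<in> \<rho>} = card (tight_pairs n d k)"
proof -
  define f where "f = (\<lambda>(\<rho>, D). (insert {Suc n} \<rho> :: nat set set, D :: nat set))"
  have iff: "(insert {Suc n} \<rho>, D) \<in> tight_pairs (Suc n) d (Suc k) \<longleftrightarrow> (\<rho>, D) \<in> tight_pairs n d k"
    if NC: "\<rho> \<in> NC n" for \<rho> D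
  proof -
    have "Suc n \<notin> outer n \<rho>" by (simp add: outer_def)
    then show ?thesis
      using card_insert_Suc[OF NC] outer_insert_Suc[OF NC] cut_pairs_insert[OF NC]
      by (simp add: tight_pairs_def)
  qed
  have NC: "\<rho> \<in> NC n" if "(\<rho>, D) \<in> tight_pairs n d k" for \<rho> D
    using that by (simp add: tight_pairs_def cut_pairs_def)
  have "{(\<rho>, D) \<in> tight_pairs (Suc n) d (Suc k). {Suc n} \<in> \<rho>} = f ` tight_pairs n d k"
  proof (intro equalityI subsetI)
    fix x assume "x \<in> {(\<rho>, D) \<in> tight_pairs (Suc n) d (Suc k). {Suc n} \<in> \<rho>}"
    then obtain \<rho> D where x: "x = (\<rho>, D)" "(\<rho>, D) \<in> tight_pairs (Suc n) d (Suc k)" "{Suc n} \<in> \<rho>"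
      by auto
    then have NC': "\<rho> \<in> NC (Suc n)" by (simp add: tight_pairs_def cut_pairs_def)
    from NC' have r: "\<rho> = insert {Suc n} (drop_point (Suc n) \<rho>)"
      using x(3) by (cases rule: NC_Suc_cases) auto
    then have "(drop_point (Suc n) \<rho>, D) \<in> tight_pairs n d k"
      using iff[OF NC_drop_point[OF NC']] x by metis
    moreover have "x = f (drop_point (Suc n) \<rho>, D)" using r x by (simp add: f_def)
    ultimately show "x \<in> f ` tight_pairs n d k" by blast
  next
    fix x assume "x \<in> f ` tight_pairs n d k"
    then obtain \<rho> D where "x = (insert {Suc n} \<rho>, D)" and t: "(\<rho>, D) \<in> tight_pairs n d k"
      unfolding f_def by auto
    then show "x \<in> {(\<rho>, D) \<in> tight_pairs (Suc n) d (Suc k). {Suc n} \<in> \<rho>}"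
      using iff[OF NC[OF t]] by simp
  qed
  moreover have "inj_on f (tight_pairs n d k)"
  proof (rule inj_onI)
    fix x y assume xy: "x \<in> tight_pairs n d k" "y \<in> tight_pairs n d k" "f x = f y"
    obtain \<rho> D \<sigma> C where [simp]: "x = (\<rho>, D)" "y = (\<sigma>, C)" by (metis surj_pair)
    have "(\<rho>, D) \<in> tight_pairs n d k" "(\<sigma>, C) \<in> tight_pairs n d k"
      using xy(1,2) by simp_all
    moreover have "insert {Suc n} \<rho> = insert {Suc n} \<sigma>" and DC: "D = C"
      using xy(3) by (simp_all add: f_def)
    ultimately have "\<rho> = \<sigma>"
      using drop_point_insert[OF NC] by metis
    then show "x = y" using DC by simp
  qed
  ultimately show ?thesis by (simp add: card_image)
qed

text \<open>The old outer positions that survive the gluing are those below \<open>u\<close>, and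
  distinct elements of \<open>outer n \<rho>\<close> have distinct sets of smaller elements.\<close>

lemma glue_inj_point:
  assumes NC: "\<rho> \<in> NC n" and u: "u \<in> outer n \<rho>" "u \<ge> 1" and v: "v \<in> outer n \<rho>" "v \<ge> 1"
    and eq: "glue \<rho> u (Suc n) = glue \<rho> v (Suc n)"
  shows "u = v"
proof -
  have "{i \<in> outer n \<rho>. i < u} = {i \<in> outer n \<rho>. i < v}"
  proof -
    have eq': "insert (Suc n) {i \<in> outer n \<rho>. i < u} = insert (Suc n) {i \<in> outer n \<rho>. i < v}"
      using outer_glue[OF NC u] outer_glue[OF NC v] eq by simp
    have "Suc n \<notin> {i \<in> outer n \<rho>. i < x}" for x by (auto simp: outer_def)
    from insert_ident[THEN iffD1, OF this this eq'] show ?thesis .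
  qed
  then show ?thesis using u v by (metis (mono_tags, lifting) mem_Collect_eq nat_neq_iff)
qed

text \<open>Each pair arises once from a pair with one cut fewer, an outer point \<open>u\<close> of
  rank \<open>Suc k\<close> (these \<open>Suc k\<close> positions and the new top form the new outer
  set) and a new cut \<open>e\<close> among the outer points from \<open>u\<close> on. With
  \<open>Suc l\<close> outer points there are \<open>Suc l - Suc k = l - k\<close> choices. A
  positive rank also excludes \<open>u = 0\<close>.\<close>

lemma card_tight_pairs_glued:
  "card {(\<rho>, D) \<in> tight_pairs (Suc n) (Suc d) (Suc k). {Suc n} \<notin> \<rho>} =
     (\<Sum>l\<le>n. (l - k) * card (tight_pairs n d l))"
proof -
  let ?A = "\<Union>l\<le>n. tight_pairs n d l"
  let ?B = "\<lambda>(\<rho>, D :: nat set). {(u, e). u \<in> outer n \<rho> \<and> e \<in> outer n \<rho> \<and> u \<le> e \<and>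
               card {i \<in> outer n \<rho>. i < u} = Suc k}"
  define g where "g = (\<lambda>((\<rho>, D), (u, e)). (glue \<rho> u (Suc n) :: nat set set, insert (e :: nat) D :: nat set))"
  have NC: "\<rho> \<in> NC n" if "(\<rho>, D) \<in> ?A" for \<rho> D
    using that by (auto simp: tight_pairs_def cut_pairs_def)
  have u1: "u \<ge> 1" if "card {i \<in> outer n \<rho>. i < u} = Suc k" for u \<rho>
    using that by (cases u) auto
  have "g ` Sigma ?A ?B = {(\<rho>, D) \<in> tight_pairs (Suc n) (Suc d) (Suc k). {Suc n} \<notin> \<rho>}"
  proof (intro equalityI subsetI)
    fix x assume "x \<in> g ` Sigma ?A ?B"
    then obtain z where z: "z \<in> Sigma ?A ?B" "x = g z" by blast
    obtain \<rho> D u e where zz: "z = ((\<rho>, D), (u, e))" by (metis surj_pair)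
    have x: "x = (glue \<rho> u (Suc n), insert e D)" using z(2) by (simp add: zz g_def)
    have A: "(\<rho>, D) \<in> ?A" using z(1) unfolding zz by (rule SigmaE2)
    have B: "u \<in> outer n \<rho>" "e \<in> outer n \<rho>" "u \<le> e" "card {i \<in> outer n \<rho>. i < u} = Suc k"
      using z(1) unfolding zz by auto
    note NC = NC[OF A] and u1 = u1[OF B(4)]
    have cp: "(\<rho>, D) \<in> cut_pairs n" and cD: "card D = d" "card \<rho> + d = n"
      using A by (auto simp: tight_pairs_def)
    have "e \<notin> D" using outer_Int_cuts[OF cp] B by auto
    moreover have "finite D" using cp finite_subset by (fastforce simp: cut_pairs_def)
    moreover have "card (outer (Suc n) (glue \<rho> u (Suc n))) = Suc (Suc k)"
    proof -
      have "Suc n \<notin> {i \<in> outer n \<rho>. i < u}" by (auto simp: outer_def)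
      then show ?thesis using B(4) unfolding outer_glue[OF NC B(1) u1] by simp
    qed
    ultimately have "x \<in> tight_pairs (Suc n) (Suc d) (Suc k)"
      using cut_pairs_glue[OF cp B(1) u1 B(2,3)] cD card_glue[OF NC] by (simp add: x tight_pairs_def)
    moreover have "{Suc n} \<notin> glue \<rho> u (Suc n)"
    proof
      assume "{Suc n} \<in> glue \<rho> u (Suc n)"
      then obtain C where C: "C \<in> \<rho>" "{Suc n} = (if u \<in> C then insert (Suc n) C else C)"
        by (auto simp: glue_def)
      have "u \<le> n" using B by (simp add: outer_def)
      then show False using C NC_Suc_notin[OF NC C(1)] by (auto split: if_splits)
    qed
    ultimately show "x \<in> {(\<rho>, D) \<in> tight_pairs (Suc n) (Suc d) (Suc k). {Suc n} \<notin> \<rho>}" by (simp add: x)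
  next
    fix x assume "x \<in> {(\<rho>, D) \<in> tight_pairs (Suc n) (Suc d) (Suc k). {Suc n} \<notin> \<rho>}"
    then obtain \<rho> D where x: "x = (\<rho>, D)" and t: "(\<rho>, D) \<in> tight_pairs (Suc n) (Suc d) (Suc k)"
      and nin: "{Suc n} \<notin> \<rho>" by auto
    have cp: "(\<rho>, D) \<in> cut_pairs (Suc n)" and cD: "card D = Suc d" "card \<rho> + Suc d = Suc n"
      and co: "card (outer (Suc n) \<rho>) = Suc (Suc k)"
      using t by (auto simp: tight_pairs_def)
    have NC': "\<rho> \<in> NC (Suc n)" using cp by (simp add: cut_pairs_def)
    define \<rho>' where "\<rho>' = drop_point (Suc n) \<rho>"
    have NC: "\<rho>' \<in> NC n" unfolding \<rho>'_def by (rule NC_drop_point[OF NC'])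
    from NC' obtain u where u: "u \<ge> 1" "u \<in> outer n \<rho>'" and r: "\<rho> = glue \<rho>' u (Suc n)"
      unfolding \<rho>'_def using nin by (cases rule: NC_Suc_cases) auto
    let ?E = "{i \<in> outer n \<rho>'. u \<le> i}"
    have cp': "(\<rho>', D - ?E) \<in> cut_pairs n" and le: "card (D \<inter> ?E) \<le> 1"
      using cut_pairs_unglue[OF NC u(2,1)] cp r by auto
    have cr: "card \<rho> = card \<rho>'" unfolding r by (rule card_glue[OF NC])
    have finD: "finite D" using cD card.infinite by force
    have split: "card D = card (D - ?E) + card (D \<inter> ?E)"
      using card_Int_Diff[OF finD, of ?E] by simp
    \<comment> \<open>Removing the point costs no block and at most one cut; since the given pair
      attains its bound, both estimates must be equalities.\<close>
    have "card (D - ?E) + card \<rho>' \<le> n" by (rule cut_pairs_card_le[OF cp'])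
    then have c1: "card (D \<inter> ?E) = 1" and c2: "card (D - ?E) = d" using le split cD cr by auto
    then obtain e where e: "D \<inter> ?E = {e}" using card_1_singletonE by blast
    have De: "D = insert e (D - ?E)" using e by blast
    have eE: "e \<in> outer n \<rho>'" "u \<le> e" using e by blast+
    have "card (insert (Suc n) {i \<in> outer n \<rho>'. i < u}) = Suc (Suc k)"
      using co unfolding r outer_glue[OF NC u(2,1)] .
    moreover have "Suc n \<notin> {i \<in> outer n \<rho>'. i < u}" by (auto simp: outer_def)
    ultimately have rank: "card {i \<in> outer n \<rho>'. i < u} = Suc k" by simp
    have "(\<rho>', D - ?E) \<in> ?A"
    proof -
      have "card (outer n \<rho>') \<le> Suc n" "card (outer n \<rho>') > 0"
        using card_outer_bounds(1)[OF NC] outer_top[of n \<rho>'] by (auto simp: card_gt_0_iff simp del: outer_top)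
      then obtain l where "l \<le> n" "card (outer n \<rho>') = Suc l" by (metis Suc_le_mono gr0_implies_Suc)
      then show ?thesis using cp' c2 cD cr by (auto simp: tight_pairs_def)
    qed
    moreover have "(u, e) \<in> ?B (\<rho>', D - ?E)" using u eE rank by simp
    moreover have "x = g ((\<rho>', D - ?E), (u, e))" unfolding g_def x using r De by simp
    ultimately show "x \<in> g ` Sigma ?A ?B" by blast
  qed
  moreover have "inj_on g (Sigma ?A ?B)"
  proof (rule inj_onI)
    fix x y assume xy: "x \<in> Sigma ?A ?B" "y \<in> Sigma ?A ?B" "g x = g y"
    obtain \<rho> D u e where x: "x = ((\<rho>, D), (u, e))" by (metis surj_pair)
    obtain \<sigma> C v f where y: "y = ((\<sigma>, C), (v, f))" by (metis surj_pair)
    have X: "(\<rho>, D) \<in> ?A" "u \<in> outer n \<rho>" "e \<in> outer n \<rho>" "card {i \<in> outer n \<rho>. i < u} = Suc k"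
      using xy(1) unfolding x by auto
    have Y: "(\<sigma>, C) \<in> ?A" "v \<in> outer n \<sigma>" "f \<in> outer n \<sigma>" "card {i \<in> outer n \<sigma>. i < v} = Suc k"
      using xy(2) unfolding y by auto
    have eq: "glue \<rho> u (Suc n) = glue \<sigma> v (Suc n)" "insert e D = insert f C"
      using xy(3) unfolding g_def x y by auto
    have rs: "\<rho> = \<sigma>"
      using eq(1) drop_point_glue[OF NC[OF X(1)]] drop_point_glue[OF NC[OF Y(1)]] by metis
    have "u = v"
      using glue_inj_point[OF NC[OF X(1)] X(2) u1[OF X(4)], of v] Y u1[OF Y(4)] eq(1) rs by simp
    moreover have "(\<rho>, D) \<in> cut_pairs n" "(\<rho>, C) \<in> cut_pairs n"
      using X(1) Y(1) rs by (auto simp: tight_pairs_def)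
    then have dj: "outer n \<rho> \<inter> D = {}" "outer n \<rho> \<inter> C = {}"
      using outer_Int_cuts by auto
    \<comment> \<open>Outer positions are never cuts, so the added cut is recovered as the one outer
      element of the enlarged set.\<close>
    have "e \<notin> D" "e \<notin> C" "f \<notin> C" using dj X(3) Y(3) rs by auto
    then have "e = f" using eq(2) by blast
    moreover have "D = C"
      using insert_ident[OF \<open>e \<notin> D\<close> \<open>e \<notin> C\<close>] eq(2) \<open>e = f\<close> by simp
    ultimately show "x = y" using x y rs by simp
  qed
  ultimately have "card {(\<rho>, D) \<in> tight_pairs (Suc n) (Suc d) (Suc k). {Suc n} \<notin> \<rho>} = card (Sigma ?A ?B)"
    by (metis (no_types, lifting) card_image)
  also have "\<dots> = (\<Sum>x\<in>?A. card (?B x))"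
  proof (rule card_SigmaI)
    show "finite ?A" by (simp add: finite_tight_pairs)
    show "\<forall>x\<in>?A. finite (?B x)"
    proof
      fix x :: "nat set set \<times> nat set"
      have "?B x \<subseteq> outer n (fst x) \<times> outer n (fst x)" by (auto split: prod.splits)
      then show "finite (?B x)" by (rule finite_subset) simp
    qed
  qed
  also have "\<dots> = (\<Sum>x\<in>?A. card (outer n (fst x)) - Suc k)"
    by (intro sum.cong refl) (auto simp: card_pairs_rank split: prod.splits)
  also have "\<dots> = (\<Sum>l\<le>n. \<Sum>x\<in>tight_pairs n d l. card (outer n (fst x)) - Suc k)"
    by (rule sum.UNION_disjoint) (auto simp: finite_tight_pairs, auto simp: tight_pairs_def)
  also have "\<dots> = (\<Sum>l\<le>n. \<Sum>x\<in>tight_pairs n d l. l - k)"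
    by (intro sum.cong refl) (auto simp: tight_pairs_def)
  finally show ?thesis by (simp add: mult.commute)
qed

text \<open>Gluing creates no block, so it would need \<open>Suc n\<close> blocks on
  \<open>n\<close> points.\<close>

lemma tight_pairs_Suc_no_cut:
  assumes "(\<rho>, D) \<in> tight_pairs (Suc n) 0 k"
  shows "{Suc n} \<in> \<rho>"
proof (rule ccontr)
  assume nin: "{Suc n} \<notin> \<rho>"
  have cp: "(\<rho>, D) \<in> cut_pairs (Suc n)" and c: "card D = 0" "card \<rho> = Suc n"
    using assms by (auto simp: tight_pairs_def)
  have NC': "\<rho> \<in> NC (Suc n)" using cp by (simp add: cut_pairs_def)
  define \<rho>' where "\<rho>' = drop_point (Suc n) \<rho>"
  have NC: "\<rho>' \<in> NC n" unfolding \<rho>'_def by (rule NC_drop_point[OF NC'])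
  from NC' obtain u where u: "u \<ge> 1" "u \<in> outer n \<rho>'" and r: "\<rho> = glue \<rho>' u (Suc n)"
    unfolding \<rho>'_def using nin by (cases rule: NC_Suc_cases) auto
  have "(\<rho>', D - {i \<in> outer n \<rho>'. u \<le> i}) \<in> cut_pairs n"
    using cut_pairs_unglue[OF NC u(2,1)] cp r by auto
  then show False using cut_pairs_card_le c card_glue[OF NC, of u] unfolding r by fastforce
qed

lemma card_tight_pairs_Suc_0: "card (tight_pairs (Suc n) 0 (Suc k)) = card (tight_pairs n 0 k)"
proof -
  have "tight_pairs (Suc n) 0 (Suc k) = {(\<rho>, D) \<in> tight_pairs (Suc n) 0 (Suc k). {Suc n} \<in> \<rho>}"
    using tight_pairs_Suc_no_cut[of _ _ n "Suc k"] by auto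
  then have "card (tight_pairs (Suc n) 0 (Suc k)) =
      card {(\<rho>, D) \<in> tight_pairs (Suc n) 0 (Suc k). {Suc n} \<in> \<rho>}"
    by (rule arg_cong)
  then show ?thesis by (simp only: card_tight_pairs_singleton)
qed

lemma card_tight_pairs_Suc_Suc:
  "card (tight_pairs (Suc n) (Suc d) (Suc k)) =
     card (tight_pairs n (Suc d) k) + (\<Sum>l\<le>n. (l - k) * card (tight_pairs n d l))"
proof -
  let ?T = "tight_pairs (Suc n) (Suc d) (Suc k)"
  let ?P = "{(\<rho>, D :: nat set). {Suc n} \<in> \<rho>}"
  have "?T \<inter> ?P = {(\<rho>, D) \<in> ?T. {Suc n} \<in> \<rho>}" "?T - ?P = {(\<rho>, D) \<in> ?T. {Suc n} \<notin> \<rho>}"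
    by blast+
  then have "card ?T = card {(\<rho>, D) \<in> ?T. {Suc n} \<in> \<rho>} + card {(\<rho>, D) \<in> ?T. {Suc n} \<notin> \<rho>}"
    using card_Int_Diff[OF finite_tight_pairs, of "Suc n" "Suc d" "Suc k" ?P] by simp
  then show ?thesis by (simp only: card_tight_pairs_singleton card_tight_pairs_glued)
qed

section \<open>Solving the recursion with power series\<close>

unbundle fps_syntax

text \<open>The \<open>d\<close>-th power is the generating function of the \<open>d\<close>-tuples of positive integers, weighted
  by their product.\<close>

definition part_fps :: "rat fps" where
  "part_fps = Abs_fps of_nat"

lemma part_fps_eq: "part_fps = fps_X * inverse ((1 - fps_X) ^ 2)"
  unfolding fps_one_over_one_minus_fps_X_squared part_fps_def
  by (rule fps_ext) (auto simp: fps_X_mult_nth)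

text \<open>The power is X^(d+1) times the negative binomial series of exponent 2(d+1). The
  complementary lower index \<open>2 * d + 1\<close> does not depend on \<open>n\<close> and also
  fits \<open>n < Suc d\<close>, where both sides vanish.\<close>

lemma part_fps_power_nth:
  "part_fps ^ Suc d $ n = of_nat ((n + d) choose (2 * d + 1))"
proof -
  have "inverse ((1 - fps_X) ^ 2) ^ Suc d = inverse ((1 - fps_X :: rat fps) ^ (2 * Suc d))"
    by (simp only: fps_inverse_power power_mult)
  then have "part_fps ^ Suc d = fps_X ^ Suc d * inverse ((1 - fps_const 1 * fps_X) ^ (2 * Suc d))"
    by (simp only: part_fps_eq power_mult_distrib fps_const_1_eq_1 mult_1_left)
  also have "\<dots> = fps_X ^ Suc d * Abs_fps (\<lambda>k. of_nat ((2 * Suc d + k - 1) choose k))"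
    by (subst one_minus_const_fps_X_neg_power') simp_all
  finally have eq: "part_fps ^ Suc d = fps_X ^ Suc d * Abs_fps (\<lambda>k. of_nat ((2 * Suc d + k - 1) choose k))" .
  show ?thesis
  proof (cases "n < Suc d")
    case True
    then show ?thesis unfolding eq fps_X_power_mult_nth by simp
  next
    case False
    then have n: "n + d = (2 * Suc d + (n - Suc d) - 1)" "2 * d + 1 = (n + d) - (n - Suc d)" by simp_all
    have "(n + d) choose (2 * d + 1) = (n + d) choose (n - Suc d)"
      unfolding n(2) using False by (intro binomial_symmetric[symmetric]) simp
    then show ?thesis unfolding eq fps_X_power_mult_nth using False n(1) by (simp add: add.commute)
  qed
qed

lemma part_fps_convolution:
  "(\<Sum>w\<le>N. of_nat w * part_fps ^ d $ (N - w)) = part_fps ^ Suc d $ N"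
  by (simp add: fps_mult_nth part_fps_def atLeast0AtMost)

text \<open>Apply X d/dX to the power: it multiplies the \<open>N\<close>-th coefficient by
  \<open>N\<close>, turns \<open>part_fps\<close> into the series of squares, and the power rule
  yields the factor \<open>Suc d\<close>.\<close>

lemma part_fps_convolution2:
  "(\<Sum>w\<le>N. of_nat w ^ 2 * part_fps ^ d $ (N - w)) * of_nat (Suc d) = of_nat N * part_fps ^ Suc d $ N"
proof -
  let ?Q = "fps_X * fps_deriv part_fps"
  have Q: "?Q $ w = of_nat w ^ 2" for w
    by (cases w) (auto simp: part_fps_def power2_eq_square)
  have "of_nat N * part_fps ^ Suc d $ N = (fps_X * fps_deriv (part_fps ^ Suc d)) $ N"
    by (cases N) (simp_all del: power_Suc)
  also have "fps_X * fps_deriv (part_fps ^ Suc d) = of_nat (Suc d) * (?Q * part_fps ^ d)"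
    unfolding fps_deriv_power' by (simp add: mult_ac)
  also have "(of_nat (Suc d) * (?Q * part_fps ^ d)) $ N = of_nat (Suc d) * (?Q * part_fps ^ d) $ N"
    by (metis fps_mult_left_const_nth fps_of_nat)
  also have "(?Q * part_fps ^ d) $ N = (\<Sum>w\<le>N. of_nat w ^ 2 * part_fps ^ d $ (N - w))"
    unfolding fps_mult_nth[of ?Q] Q by (simp add: atLeast0AtMost)
  finally show ?thesis by (simp add: mult_ac)
qed

text \<open>The recursion is that of the powers of a series: if F = z (1 + y F / (1 - F)^2), then
  F^(k+1) equals z times F^k plus z y times the sum of w F^(k+w) over all w. So the cardinality is
  the coefficient of z^n y^d in F^k, and the formula is the one of Lagrange inversion, with
  \<open>n choose d\<close> from expanding (1 + y X / (1 - X)^2)^n. Here it is verified by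
  induction, multiplied by \<open>n\<close> to avoid division.\<close>

lemma card_tight_pairs:
  assumes "k \<le> n" "0 < n"
  shows "of_nat n * of_nat (card (tight_pairs n d k)) =
           of_nat k * of_nat (n choose d) * part_fps ^ d $ (n - k)"
  using assms
proof (induction n arbitrary: d k)
  case (Suc n)
  show ?case
  proof (cases k)
    case 0
    then show ?thesis by (simp add: tight_pairs_Suc_0)
  next
    case (Suc k')
    then have k': "k' \<le> n" using Suc.prems by simp
    show ?thesis
    \<comment> \<open>Multiplied by \<open>n\<close>, the formula says nothing at
      \<open>n = 0\<close>; so its first instance is computed from the recursion.\<close>
    proof (cases "n = 0")
      case True
      then have [simp]: "n = 0" "k' = 0" using k' by simp_all
      show ?thesis
        by (cases d) (simp_all add: Suc card_tight_pairs_Suc_0 card_tight_pairs_Suc_Suc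
            card_tight_pairs_0 part_fps_def)
    next
      case False
      then have n: "0 < n" by simp
      have IH: "of_nat n * of_nat (card (tight_pairs n d l)) =
           of_nat l * of_nat (n choose d) * part_fps ^ d $ (n - l)" if "l \<le> n" for d l
        using Suc.IH that n by blast
      show ?thesis
      proof (cases d)
        case 0
        have "of_nat n * of_nat (card (tight_pairs n 0 k')) = (of_nat n * (if k' = n then 1 else 0) :: rat)"
          using IH[OF k', of 0] k' by (auto simp: fps_one_nth)
        then have "of_nat (card (tight_pairs n 0 k')) = (if k' = n then 1 else 0 :: rat)"
          using n by (subst (asm) mult_left_cancel) auto
        then show ?thesis using k' by (auto simp: Suc 0 card_tight_pairs_Suc_0)
      next
        case (Suc d')
        define N where "N = n - k'"
        define Q where "Q = part_fps ^ Suc d' $ N"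
        define S where "S = (\<Sum>w\<le>N. of_nat w ^ 2 * part_fps ^ d' $ (N - w))"
        define c where "c = (of_nat (n choose d') :: rat)"
        have S: "S * of_nat (Suc d') = of_nat N * Q"
          unfolding S_def Q_def by (rule part_fps_convolution2)
        have N: "of_nat n = (of_nat N + of_nat k' :: rat)"
          using k' unfolding N_def by (metis le_add_diff_inverse2 of_nat_add)
        \<comment> \<open>Truncated subtraction kills the terms with \<open>l < k'\<close>. With
          \<open>l = k' + w\<close>, the weight \<open>w * (k' + w)\<close> splits into
          \<open>k' * w\<close> and \<open>w ^ 2\<close>, one for each of the two
          convolutions.\<close>
        have "of_nat n * (\<Sum>l\<le>n. of_nat (l - k') * of_nat (card (tight_pairs n d' l)))
            = (\<Sum>l\<le>n. of_nat (l - k') * (of_nat l * c * part_fps ^ d' $ (n - l)))"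
          unfolding sum_distrib_left c_def by (intro sum.cong refl) (simp add: IH[symmetric])
        also have "\<dots> = (\<Sum>l\<in>{k'..n}. of_nat (l - k') * (of_nat l * c * part_fps ^ d' $ (n - l)))"
          by (rule sum.mono_neutral_right) auto
        also have "\<dots> = (\<Sum>w\<le>N. of_nat w * (of_nat (k' + w) * c * part_fps ^ d' $ (N - w)))"
          using k' by (intro sum.reindex_bij_witness[of _ "\<lambda>w. k' + w" "\<lambda>l. l - k'"]) (auto simp: N_def)
        also have "\<dots> = c * (of_nat k' * (\<Sum>w\<le>N. of_nat w * part_fps ^ d' $ (N - w)) + S)"
          unfolding S_def sum_distrib_left sum.distrib[symmetric]
          by (intro sum.cong refl) (simp add: algebra_simps power2_eq_square)
        finally have sum: "of_nat n * (\<Sum>l\<le>n. of_nat (l - k') * of_nat (card (tight_pairs n d' l)))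
            = c * (of_nat k' * Q + S)"
          unfolding part_fps_convolution Q_def .
        have first: "of_nat n * of_nat (card (tight_pairs n (Suc d') k')) =
            of_nat k' * of_nat (n choose Suc d') * Q"
          using IH[OF k', of "Suc d'"] unfolding Q_def N_def .
        have absorb: "of_nat (Suc d') * of_nat (Suc n choose Suc d') = (of_nat (Suc n) * c :: rat)"
          unfolding c_def of_nat_mult[symmetric] by (simp only: Suc_times_binomial)
        have pascal: "of_nat (Suc n choose Suc d') = (of_nat (n choose Suc d') + c :: rat)"
          unfolding c_def by simp
        define b where "b = (of_nat (n choose Suc d') :: rat)"
        have bc: "of_nat (Suc d') * (b + c) = of_nat (Suc n) * c"
          using absorb pascal by (simp only: b_def)
        have nX: "of_nat n * (of_nat (card (tight_pairs n (Suc d') k')) +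
              (\<Sum>l\<le>n. of_nat (l - k') * of_nat (card (tight_pairs n d' l))))
            = of_nat k' * b * Q + c * (of_nat k' * Q + S)"
          unfolding distrib_left sum first b_def ..
        \<comment> \<open>The factor \<open>Suc d'\<close> makes both \<open>bc\<close> and
          \<open>S\<close> applicable; what remains is \<open>k' * Suc n + N = n * Suc k'\<close>,
          by \<open>n = N + k'\<close>.\<close>
        have "of_nat (Suc d') * (of_nat (Suc n) * (of_nat k' * b * Q + c * (of_nat k' * Q + S)))
            = of_nat (Suc d') * (of_nat n * (of_nat (Suc k') * (b + c) * Q))"
        proof -
          have "of_nat (Suc d') * (of_nat (Suc n) * (of_nat k' * b * Q + c * (of_nat k' * Q + S)))
            = of_nat (Suc n) * (of_nat k' * Q * (of_nat (Suc d') * (b + c)) + c * (S * of_nat (Suc d')))"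
            by (simp add: algebra_simps)
          also have "\<dots> = of_nat (Suc n) * (of_nat k' * Q * (of_nat (Suc n) * c) + c * (of_nat N * Q))"
            by (simp only: S bc)
          also have "\<dots> = of_nat n * (of_nat (Suc k') * (of_nat (Suc n) * c) * Q)"
            using N by (simp add: algebra_simps)
          also have "\<dots> = of_nat n * (of_nat (Suc k') * (of_nat (Suc d') * (b + c)) * Q)"
            by (simp only: bc)
          finally show ?thesis by (simp add: mult_ac)
        qed
        then have nY: "of_nat (Suc n) * (of_nat k' * b * Q + c * (of_nat k' * Q + S))
            = of_nat n * (of_nat (Suc k') * (b + c) * Q)"
          by (subst (asm) mult_left_cancel) simp_all
        have "of_nat n * (of_nat (Suc n) * (of_nat (card (tight_pairs n (Suc d') k')) +
              (\<Sum>l\<le>n. of_nat (l - k') * of_nat (card (tight_pairs n d' l)))))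
            = of_nat n * (of_nat (Suc k') * (b + c) * Q)"
          unfolding mult.left_commute[of "of_nat n" "of_nat (Suc n)"] nX nY ..
        then have "of_nat (Suc n) * (of_nat (card (tight_pairs n (Suc d') k')) +
              (\<Sum>l\<le>n. of_nat (l - k') * of_nat (card (tight_pairs n d' l))))
            = of_nat (Suc k') * (b + c) * Q"
          using n by (subst (asm) mult_left_cancel) simp_all
        then show ?thesis
          unfolding \<open>k = Suc k'\<close> Suc card_tight_pairs_Suc_Suc pascal diff_Suc_Suc
            N_def[symmetric] Q_def[symmetric] b_def[symmetric] of_nat_add of_nat_sum of_nat_mult .
      qed
    qed
  qed
qed simp

text \<open>Summing over \<open>k\<close> is one more convolution with \<open>part_fps\<close>,
  whose coefficients are the factors \<open>k\<close>.\<close>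

lemma card_tight_cut_pairs:
  assumes "0 < n"
  shows "n * card {(\<rho>, D) \<in> cut_pairs n. card D = d \<and> card \<rho> + d = n} =
           (n choose d) * ((n + d) choose (2 * d + 1))"
proof -
  have "{(\<rho>, D) \<in> cut_pairs n. card D = d \<and> card \<rho> + d = n} = (\<Union>k\<le>n. tight_pairs n d k)"
  proof (intro equalityI subsetI)
    fix x assume "x \<in> {(\<rho>, D) \<in> cut_pairs n. card D = d \<and> card \<rho> + d = n}"
    then obtain \<rho> D where x: "x = (\<rho>, D)" "(\<rho>, D) \<in> cut_pairs n" "card D = d" "card \<rho> + d = n"
      by auto
    have "\<rho> \<in> NC n" using x(2) by (simp add: cut_pairs_def)
    then have "card (outer n \<rho>) \<le> Suc n" "card (outer n \<rho>) \<ge> 2"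
      using card_outer_bounds assms by blast+
    then obtain k where "card (outer n \<rho>) = Suc k" "k \<le> n" by (cases "card (outer n \<rho>)") auto
    then show "x \<in> (\<Union>k\<le>n. tight_pairs n d k)" using x by (auto simp: tight_pairs_def)
  qed (auto simp: tight_pairs_def)
  moreover have "card (\<Union>k\<le>n. tight_pairs n d k) = (\<Sum>k\<le>n. card (tight_pairs n d k))"
    by (rule card_UN_disjoint) (auto simp: finite_tight_pairs, auto simp: tight_pairs_def)
  ultimately have "of_nat (n * card {(\<rho>, D) \<in> cut_pairs n. card D = d \<and> card \<rho> + d = n}) =
      (\<Sum>k\<le>n. of_nat n * of_nat (card (tight_pairs n d k)) :: rat)"
    by (simp add: sum_distrib_left)
  also have "\<dots> = (\<Sum>k\<le>n. of_nat k * of_nat (n choose d) * part_fps ^ d $ (n - k))"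
    using assms by (intro sum.cong refl card_tight_pairs) auto
  also have "\<dots> = of_nat (n choose d) * (\<Sum>k\<le>n. of_nat k * part_fps ^ d $ (n - k))"
    by (simp add: sum_distrib_left mult_ac)
  also have "\<dots> = of_nat ((n choose d) * ((n + d) choose (2 * d + 1)))"
    by (simp only: part_fps_convolution part_fps_power_nth of_nat_mult)
  finally show ?thesis by (simp only: of_nat_eq_iff)
qed

section \<open>Distances in the Hasse diagram\<close>

definition merge :: "'a set set \<Rightarrow> 'a set \<Rightarrow> 'a set \<Rightarrow> 'a set set" where
  "merge \<pi> A B = insert (A \<union> B) (\<pi> - {A, B})"

lemma partition_on_merge:
  assumes "partition_on X \<pi>" "A \<in> \<pi>" "B \<in> \<pi>"
  shows "partition_on X (merge \<pi> A B)"
proof -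
  have "disjnt (A \<union> B) C" if "C \<in> \<pi> - {A, B}" for C
    using that partition_disjoint[OF assms(1,2), of C] partition_disjoint[OF assms(1,3), of C]
    by (auto simp: disjnt_def)
  moreover have "disjnt C D" if "C \<in> \<pi>" "D \<in> \<pi>" "C \<noteq> D" for C D
    using partition_disjoint[OF assms(1) that] by (simp add: disjnt_def)
  ultimately have "disjnt C D" if "C \<in> merge \<pi> A B" "D \<in> merge \<pi> A B" "C \<noteq> D" for C D
    using that unfolding merge_def by (elim insertE) (auto intro: disjnt_sym)
  moreover have "\<Union> (merge \<pi> A B) = X"
    unfolding merge_def using partition_onD1[OF assms(1)] assms(2,3) by blast
  moreover have "{} \<notin> merge \<pi> A B"
    unfolding merge_def using partition_onD3[OF assms(1)] assms(2) by auto
  ultimately show ?thesis by (intro partition_onI)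
qed

lemma refines_merge:
  assumes "partition_on X \<pi>" "A \<in> \<pi>" "B \<in> \<pi>"
  shows "refines X \<pi> (merge \<pi> A B)"
  unfolding refines_def
proof (intro conjI ballI)
  fix C assume "C \<in> \<pi>"
  then show "\<exists>Y\<in>merge \<pi> A B. C \<subseteq> Y"
    by (cases "C \<in> {A, B}") (auto simp: merge_def)
qed (use assms(1) partition_on_merge[OF assms] in blast)+

lemma refines_superset: "refines X \<pi> \<sigma> \<Longrightarrow> B \<in> \<pi> \<Longrightarrow> \<exists>T\<in>\<sigma>. B \<subseteq> T"
  by (simp add: refines_def)

lemma merge_refines:
  assumes "refines X \<pi> \<tau>" "partition_on X (merge \<pi> A B)" "S \<in> \<tau>" "A \<union> B \<subseteq> S"
  shows "refines X (merge \<pi> A B) \<tau>"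
  unfolding refines_def
proof (intro conjI ballI)
  fix C assume "C \<in> merge \<pi> A B"
  then consider "C = A \<union> B" | "C \<in> \<pi>" by (auto simp: merge_def)
  then show "\<exists>Y\<in>\<tau>. C \<subseteq> Y"
  proof cases
    case 1
    then show ?thesis using assms(3,4) by blast
  next
    case 2
    then show ?thesis using assms(1) by (simp add: refines_def)
  qed
qed (use assms(1,2) in \<open>simp_all add: refines_def\<close>)

lemma card_merge:
  assumes "partition_on X \<pi>" "A \<in> \<pi>" "B \<in> \<pi>" "A \<noteq> B" "finite \<pi>"
  shows "Suc (card (merge \<pi> A B)) = card \<pi>"
proof -
  have "A \<union> B \<notin> \<pi> - {A, B}"
  proof
    assume *: "A \<union> B \<in> \<pi> - {A, B}"
    then have "A \<inter> (A \<union> B) = {}" using partition_disjoint[OF assms(1,2), of "A \<union> B"] by blast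
    then show False using assms(1,2) by (auto simp: partition_on_def)
  qed
  then have "card (merge \<pi> A B) = Suc (card (\<pi> - {A, B}))"
    unfolding merge_def using assms(5) by simp
  moreover have "card (\<pi> - {A, B}) = card \<pi> - 2"
    using assms by (subst card_Diff_subset) auto
  moreover have "card {A, B} \<le> card \<pi>" using assms by (intro card_mono) auto
  ultimately show ?thesis using assms(4) by simp
qed

lemma refines_card_le:
  assumes "refines X \<pi> \<sigma>" "finite \<pi>"
  shows "card \<sigma> \<le> card \<pi>"
proof -
  define f where "f B = (SOME S. S \<in> \<sigma> \<and> B \<subseteq> S)" for B
  have p: "partition_on X \<pi>" "partition_on X \<sigma>" using assms by (auto simp: refines_def)
  have f: "f B \<in> \<sigma> \<and> B \<subseteq> f B" if "B \<in> \<pi>" for B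
  proof -
    have "\<exists>S. S \<in> \<sigma> \<and> B \<subseteq> S" using assms(1) that by (auto simp: refines_def)
    then show ?thesis unfolding f_def by (rule someI_ex)
  qed
  have "\<sigma> \<subseteq> f ` \<pi>"
  proof
    fix S assume S: "S \<in> \<sigma>"
    then obtain x where x: "x \<in> S" using partition_onD3[OF p(2)] by (metis ex_in_conv)
    then have "x \<in> X" using partition_block_subset[OF p(2) S] by blast
    then obtain B where B: "B \<in> \<pi>" "x \<in> B" using partition_ex_block[OF p(1)] by blast
    then have "f B = S" using f[OF B(1)] partition_block_eq[OF p(2) _ S _ x] by blast
    then show "S \<in> f ` \<pi>" using B by blast
  qed
  then show ?thesis using assms(2) by (meson card_image_le card_mono finite_imageI le_trans)
qed

text \<open>The two blocks to be merged contain neighbouring elements \<open>x < y\<close> of a block of the coarser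
  partition, so no third block inside that block can separate them.\<close>

lemma NC_merge_exists:
  assumes NC: "\<pi> \<in> NC n" "\<sigma> \<in> NC n" and ref: "refines {1..n} \<pi> \<sigma>" and ne: "\<pi> \<noteq> \<sigma>"
  obtains A B where "A \<in> \<pi>" "B \<in> \<pi>" "A \<noteq> B" "merge \<pi> A B \<in> NC n" "refines {1..n} (merge \<pi> A B) \<sigma>"
proof -
  note p = NC_partition[OF NC(1)] and q = NC_partition[OF NC(2)]
  have "\<not> refines {1..n} \<sigma> \<pi>" using refines_asym[OF ref] ne by blast
  then have "\<exists>S\<in>\<sigma>. \<forall>B\<in>\<pi>. \<not> S \<subseteq> B" using p q by (simp add: refines_def)
  then obtain S where S: "S \<in> \<sigma>" and nsub: "\<And>B. B \<in> \<pi> \<Longrightarrow> \<not> S \<subseteq> B" by blast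
  have Sn: "S \<subseteq> {1..n}" by (rule partition_block_subset[OF q S])
  then have fin: "finite S" by (rule finite_subset) simp
  have inS: "B \<subseteq> S" if B: "B \<in> \<pi>" "b \<in> B" "b \<in> S" for B b
  proof -
    obtain T where T: "T \<in> \<sigma>" "B \<subseteq> T" using refines_superset[OF ref B(1)] by blast
    then have "T = S" using partition_block_eq[OF q T(1) S, of b] B by blast
    then show ?thesis using T by simp
  qed
  have "S \<noteq> {}" using q S by (auto simp: partition_on_def)
  then have MinS: "Min S \<in> S" using fin by simp
  then obtain A where A: "A \<in> \<pi>" "Min S \<in> A" using partition_ex_block[OF p] Sn by blast
  have AS: "A \<subseteq> S" using inS[OF A MinS] .
  \<comment> \<open>The first point of \<open>S\<close> outside the block of \<open>Min S\<close>;
    its predecessor \<open>x\<close> in \<open>S\<close> therefore lies in \<open>A\<close>.\<close>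
  define y where "y = Min (S - A)"
  have "S - A \<noteq> {}" using nsub[OF A(1)] by blast
  then have y: "y \<in> S" "y \<notin> A" using Min_in[of "S - A"] fin unfolding y_def by auto
  have before: "z \<in> A" if "z \<in> S" "z < y" for z
  proof (rule ccontr)
    assume "z \<notin> A"
    then have "y \<le> z" unfolding y_def using fin that by simp
    then show False using that by simp
  qed
  define x where "x = Max {z \<in> S. z < y}"
  have "Min S < y" using y A fin by (metis Min_le order_le_less)
  then have "{z \<in> S. z < y} \<noteq> {}" using MinS by blast
  then have x: "x \<in> S" "x < y" using Max_in[of "{z \<in> S. z < y}"] fin unfolding x_def by auto
  have xA: "x \<in> A" using before x by blast
  have gap: "z \<le> x" if "z \<in> S" "z < y" for z
    unfolding x_def using fin that by simp
  obtain B where B: "B \<in> \<pi>" "y \<in> B" using partition_ex_block[OF p] Sn y(1) by blast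
  have BS: "B \<subseteq> S" using inS[OF B y(1)] .
  have AB: "A \<noteq> B" using y B by blast
  have pm: "partition_on {1..n} (merge \<pi> A B)" by (rule partition_on_merge[OF p A(1) B(1)])
  have key: "nested (A \<union> B) W" if W: "W \<in> \<pi>" "W \<noteq> A" "W \<noteq> B" for W
  proof -
    obtain T where T: "T \<in> \<sigma>" "W \<subseteq> T" using refines_superset[OF ref W(1)] by blast
    show ?thesis
    proof (cases "T = S")
      case False
      then have "nested S T" using NC_nestedD[OF NC(2) S T(1)] by blast
      then show ?thesis unfolding nested_def using AS BS T(2) by (meson Un_iff subsetD)
    next
      case True
      have dj: "A \<inter> W = {}" "B \<inter> W = {}"
        using partition_disjoint[OF p] A(1) B(1) W by blast+
      have side: "k < x \<longleftrightarrow> k < y" "x < k \<longleftrightarrow> y < k" if "k \<in> W" for k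
      proof -
        have k: "k \<in> S" "k \<noteq> x" "k \<noteq> y" using that T True dj xA B(2) by auto
        then have "k \<le> x \<or> y \<le> k" using gap[of k] by force
        then show "k < x \<longleftrightarrow> k < y" "x < k \<longleftrightarrow> y < k" using k(2,3) x(2) by linarith+
      qed
      have nA: "nested A W" and nB: "nested B W"
        using NC_nestedD[OF NC(1)] A(1) B(1) W by blast+
      show ?thesis
        unfolding nested_def
      proof (intro ballI impI)
        fix a c k l
        assume H: "a \<in> A \<union> B" "c \<in> A \<union> B" "k \<in> W" "l \<in> W" "k < a \<and> a < l"
        have "k < x \<and> x < l"
        proof (cases "a \<in> A")
          case True
          then show ?thesis using nestedD[OF nA True xA H(3,4)] H(5) by blast
        next
          case False
          then have "a \<in> B" using H(1) by blast
          then have "k < y \<and> y < l" using nestedD[OF nB _ B(2) H(3,4)] H(5) by blast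
          then show ?thesis using side H(3,4) by blast
        qed
        moreover then have "k < y \<and> y < l" using side H(3,4) by blast
        ultimately show "k < c \<and> c < l"
          using nestedD[OF nA xA _ H(3,4)] nestedD[OF nB B(2) _ H(3,4)] H(2) by blast
      qed
    qed
  qed
  have "nested V W" if VW: "V \<in> merge \<pi> A B" "W \<in> merge \<pi> A B" "V \<noteq> W" for V W
  proof -
    have dj: "V \<inter> W = {}" by (rule partition_disjoint[OF pm VW])
    consider "V \<in> \<pi>" "W \<in> \<pi>" | "V = A \<union> B" "W \<in> \<pi> - {A, B}" | "W = A \<union> B" "V \<in> \<pi> - {A, B}"
      using VW unfolding merge_def by blast
    then show ?thesis
    proof cases
      case 1
      then show ?thesis using NC_nestedD[OF NC(1)] VW by blast
    next
      case 2
      then show ?thesis using key by blast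
    next
      case 3
      then have "nested W V" using key by blast
      then show ?thesis using nested_sym dj by blast
    qed
  qed
  then have "merge \<pi> A B \<in> NC n" using pm by (simp add: NC_iff)
  moreover have "refines {1..n} (merge \<pi> A B) \<sigma>"
    using merge_refines[OF ref pm S] AS BS by simp
  ultimately show thesis using that A(1) B(1) AB by blast
qed

lemma NC_refines_card_less:
  assumes "\<pi> \<in> NC n" "\<sigma> \<in> NC n" "refines {1..n} \<pi> \<sigma>" "\<pi> \<noteq> \<sigma>"
  shows "card \<sigma> < card \<pi>"
proof -
  obtain A B where AB: "A \<in> \<pi>" "B \<in> \<pi>" "A \<noteq> B" "merge \<pi> A B \<in> NC n" "refines {1..n} (merge \<pi> A B) \<sigma>"
    using NC_merge_exists[OF assms] .
  have "card \<sigma> \<le> card (merge \<pi> A B)" by (rule refines_card_le[OF AB(5) finite_NC_elem[OF AB(4)]])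
  moreover have "Suc (card (merge \<pi> A B)) = card \<pi>"
    by (rule card_merge[OF NC_partition[OF assms(1)] AB(1-3) finite_NC_elem[OF assms(1)]])
  ultimately show ?thesis by simp
qed

lemma merge_NC_covers:
  assumes "\<pi> \<in> NC n" "A \<in> \<pi>" "B \<in> \<pi>" "A \<noteq> B" "merge \<pi> A B \<in> NC n"
  shows "NC_covers n (merge \<pi> A B) \<pi>"
proof -
  note p = NC_partition[OF assms(1)]
  have c: "Suc (card (merge \<pi> A B)) = card \<pi>"
    by (rule card_merge[OF p assms(2-4) finite_NC_elem[OF assms(1)]])
  then have "NC_less n \<pi> (merge \<pi> A B)"
    using assms refines_merge[OF p assms(2,3)] by (auto simp: NC_less_def)
  moreover have False if "NC_less n \<pi> \<sigma>" "NC_less n \<sigma> (merge \<pi> A B)" for \<sigma>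
    using that NC_refines_card_less[of \<pi> n \<sigma>] NC_refines_card_less[of \<sigma> n "merge \<pi> A B"] c
    by (auto simp: NC_less_def)
  ultimately show ?thesis by (auto simp: NC_covers_def)
qed

text \<open>The non-crossing merger from \<open>NC_merge_exists\<close> lies above
  \<open>\<pi>\<close> and not above \<open>\<sigma>\<close> strictly, so a cover must coincide with
  it.\<close>

lemma NC_covers_merge:
  assumes "NC_covers n \<sigma> \<pi>"
  obtains A B where "A \<in> \<pi>" "B \<in> \<pi>" "A \<noteq> B" "\<sigma> = merge \<pi> A B"
proof -
  have less: "\<pi> \<in> NC n" "\<sigma> \<in> NC n" "refines {1..n} \<pi> \<sigma>" "\<pi> \<noteq> \<sigma>"
    and no: "\<And>\<tau>. NC_less n \<pi> \<tau> \<Longrightarrow> \<not> NC_less n \<tau> \<sigma>"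
    using assms by (auto simp: NC_covers_def NC_less_def)
  obtain A B where AB: "A \<in> \<pi>" "B \<in> \<pi>" "A \<noteq> B" "merge \<pi> A B \<in> NC n" "refines {1..n} (merge \<pi> A B) \<sigma>"
    using NC_merge_exists[OF less] .
  have "NC_less n \<pi> (merge \<pi> A B)"
    using merge_NC_covers[OF less(1) AB(1-4)] by (simp add: NC_covers_def)
  from no[OF this] have "merge \<pi> A B = \<sigma>" using AB(4,5) less(2) by (auto simp: NC_less_def)
  then show thesis using that AB(1-3) by blast
qed

section \<open>Walks as powers of the arc relation\<close>

abbreviation hasse_arcs :: "nat \<Rightarrow> (nat set set \<times> nat set set) set" where
  "hasse_arcs n \<equiv> parcs (Hasse_NC n)"

lemma hasse_arcs_iff:
  "(\<pi>, \<rho>) \<in> hasse_arcs n \<longleftrightarrow> NC_covers n \<rho> \<pi> \<or> NC_covers n \<pi> \<rho>"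
  by (auto simp: Hasse_NC_def NC_covers_def NC_less_def)

lemma hasse_arcs_NC: "(\<pi>, \<rho>) \<in> hasse_arcs n \<Longrightarrow> \<pi> \<in> NC n \<and> \<rho> \<in> NC n"
  by (auto simp: Hasse_NC_def)

text \<open>The conjunct \<open>\<pi> \<in> NC n\<close> is there for \<open>l = 0\<close>: an empty
  walk starts at a vertex, while the zeroth power of a relation is the full identity.\<close>

lemma awalk_iff_relpow:
  "(\<exists>p. pre_digraph.awalk (with_proj (Hasse_NC n)) \<pi> p \<rho> \<and> length p = l) \<longleftrightarrow>
     \<pi> \<in> NC n \<and> (\<pi>, \<rho>) \<in> hasse_arcs n ^^ l"
proof -
  interpret pair_graph "Hasse_NC n" by (rule pair_graph_Hasse_NC)
  have verts: "pverts (Hasse_NC n) = NC n" by (simp add: Hasse_NC_def)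
  show ?thesis
  proof (induction l arbitrary: \<pi>)
    case 0
    then show ?case by (auto simp: awalk_Nil_iff verts)
  next
    case (Suc l)
    have "(\<exists>p. awalk \<pi> p \<rho> \<and> length p = Suc l) \<longleftrightarrow>
        (\<exists>\<sigma>. (\<pi>, \<sigma>) \<in> hasse_arcs n \<and> (\<exists>p. awalk \<sigma> p \<rho> \<and> length p = l))"
    proof
      assume "\<exists>p. awalk \<pi> p \<rho> \<and> length p = Suc l"
      then obtain e es where "awalk \<pi> (e # es) \<rho>" "length es = l" by (auto simp: length_Suc_conv)
      then show "\<exists>\<sigma>. (\<pi>, \<sigma>) \<in> hasse_arcs n \<and> (\<exists>p. awalk \<sigma> p \<rho> \<and> length p = l)"
        by (cases e) (auto simp: awalk_Cons_iff)
    next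
      assume "\<exists>\<sigma>. (\<pi>, \<sigma>) \<in> hasse_arcs n \<and> (\<exists>p. awalk \<sigma> p \<rho> \<and> length p = l)"
      then obtain \<sigma> p where "(\<pi>, \<sigma>) \<in> hasse_arcs n" "awalk \<sigma> p \<rho>" "length p = l" by blast
      then have "awalk \<pi> ((\<pi>, \<sigma>) # p) \<rho> \<and> length ((\<pi>, \<sigma>) # p) = Suc l"
        by (simp add: awalk_Cons_iff)
      then show "\<exists>p. awalk \<pi> p \<rho> \<and> length p = Suc l" by blast
    qed
    also have "\<dots> \<longleftrightarrow> (\<exists>\<sigma>. (\<pi>, \<sigma>) \<in> hasse_arcs n \<and> (\<sigma>, \<rho>) \<in> hasse_arcs n ^^ l)"
      unfolding Suc.IH using hasse_arcs_NC by blast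
    also have "\<dots> \<longleftrightarrow> \<pi> \<in> NC n \<and> (\<pi>, \<rho>) \<in> hasse_arcs n ^^ Suc l"
      using hasse_arcs_NC by (metis relpow_Suc_D2 relpow_Suc_I2)
    finally show ?case .
  qed
qed

lemma d_H_le:
  assumes "\<pi> \<in> NC n" "(\<pi>, \<rho>) \<in> hasse_arcs n ^^ l"
  shows "d_H n \<pi> \<rho> \<le> ereal (real l)"
proof -
  obtain p where "pre_digraph.awalk (with_proj (Hasse_NC n)) \<pi> p \<rho>" "length p = l"
    using assms awalk_iff_relpow by blast
  then show ?thesis unfolding d_H_eq_INF_length by (metis (mono_tags, lifting) INF_lower mem_Collect_eq)
qed

lemma d_H_ge:
  assumes "\<And>l. (\<pi>, \<rho>) \<in> hasse_arcs n ^^ l \<Longrightarrow> k \<le> l"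
  shows "ereal (real k) \<le> d_H n \<pi> \<rho>"
  unfolding d_H_eq_INF_length
proof (rule INF_greatest)
  fix p assume "p \<in> {p. pre_digraph.awalk (with_proj (Hasse_NC n)) \<pi> p \<rho>}"
  then have "(\<pi>, \<rho>) \<in> hasse_arcs n ^^ length p" using awalk_iff_relpow by blast
  then show "ereal (real k) \<le> ereal (real (length p))" using assms by simp
qed

lemma relpow_symI: "sym R \<Longrightarrow> (x, y) \<in> R ^^ l \<Longrightarrow> (y, x) \<in> R ^^ l"
proof (induction l arbitrary: y)
  case (Suc l)
  from Suc.prems(2) obtain z where "(x, z) \<in> R ^^ l" "(z, y) \<in> R" by auto
  then show ?case using Suc by (meson relpow_Suc_I2 symD)
qed simp

lemma refines_relpow:
  assumes "\<pi> \<in> NC n" "\<sigma> \<in> NC n" "refines {1..n} \<pi> \<sigma>"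
  shows "(\<pi>, \<sigma>) \<in> hasse_arcs n ^^ (card \<pi> - card \<sigma>)"
  using assms
proof (induction "card \<pi>" arbitrary: \<pi> rule: less_induct)
  case less
  show ?case
  proof (cases "\<pi> = \<sigma>")
    case False
    obtain A B where AB: "A \<in> \<pi>" "B \<in> \<pi>" "A \<noteq> B" "merge \<pi> A B \<in> NC n" "refines {1..n} (merge \<pi> A B) \<sigma>"
      using NC_merge_exists[OF less.prems False] .
    have c: "Suc (card (merge \<pi> A B)) = card \<pi>"
      by (rule card_merge[OF NC_partition[OF less.prems(1)] AB(1-3) finite_NC_elem[OF less.prems(1)]])
    have "(merge \<pi> A B, \<sigma>) \<in> hasse_arcs n ^^ (card (merge \<pi> A B) - card \<sigma>)"
      using less.hyps[of "merge \<pi> A B"] c AB less.prems by auto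
    moreover have "(\<pi>, merge \<pi> A B) \<in> hasse_arcs n"
      using merge_NC_covers[OF less.prems(1) AB(1-4)] by (simp add: hasse_arcs_iff)
    ultimately have "(\<pi>, \<sigma>) \<in> hasse_arcs n ^^ Suc (card (merge \<pi> A B) - card \<sigma>)"
      by (rule relpow_Suc_I2[rotated])
    moreover have "card \<sigma> \<le> card (merge \<pi> A B)"
      by (rule refines_card_le[OF AB(5) finite_NC_elem[OF AB(4)]])
    ultimately show ?thesis using c by (metis Suc_diff_le)
  qed simp
qed

lemma sym_hasse_arcs: "sym (hasse_arcs n)"
  by (auto simp: sym_def hasse_arcs_iff)

lemma d_H_le_coarser:
  assumes "\<pi> \<in> NC n" "\<rho> \<in> NC n" "\<sigma> \<in> NC n" "refines {1..n} \<pi> \<sigma>" "refines {1..n} \<rho> \<sigma>"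
  shows "d_H n \<pi> \<rho> \<le> ereal (real ((card \<pi> - card \<sigma>) + (card \<rho> - card \<sigma>)))"
proof (rule d_H_le[OF assms(1)])
  have "(\<pi>, \<sigma>) \<in> hasse_arcs n ^^ (card \<pi> - card \<sigma>)"
    "(\<sigma>, \<rho>) \<in> hasse_arcs n ^^ (card \<rho> - card \<sigma>)"
    using refines_relpow assms relpow_symI[OF sym_hasse_arcs] by auto
  then show "(\<pi>, \<rho>) \<in> hasse_arcs n ^^ ((card \<pi> - card \<sigma>) + (card \<rho> - card \<sigma>))"
    unfolding relpow_add by (rule relcompI)
qed

lemma d_H_le_finer:
  assumes "\<pi> \<in> NC n" "\<rho> \<in> NC n" "\<sigma> \<in> NC n" "refines {1..n} \<sigma> \<pi>" "refines {1..n} \<sigma> \<rho>"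
  shows "d_H n \<pi> \<rho> \<le> ereal (real ((card \<sigma> - card \<pi>) + (card \<sigma> - card \<rho>)))"
proof (rule d_H_le[OF assms(1)])
  have "(\<pi>, \<sigma>) \<in> hasse_arcs n ^^ (card \<sigma> - card \<pi>)"
    "(\<sigma>, \<rho>) \<in> hasse_arcs n ^^ (card \<sigma> - card \<rho>)"
    using refines_relpow assms relpow_symI[OF sym_hasse_arcs] by auto
  then show "(\<pi>, \<rho>) \<in> hasse_arcs n ^^ ((card \<sigma> - card \<pi>) + (card \<sigma> - card \<rho>))"
    unfolding relpow_add by (rule relcompI)
qed

text \<open>In the semimodular lattice of all partitions, the distance of two partitions is realised
  through their join; \<open>\<tau>\<close> plays the role of (a lower bound for) that join.\<close>

lemma relpow_common_coarsening:
  assumes "\<pi> \<in> NC n" "(\<pi>, \<sigma>) \<in> hasse_arcs n ^^ l"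
  shows "\<exists>\<tau>. refines {1..n} \<pi> \<tau> \<and> refines {1..n} \<sigma> \<tau> \<and> card \<pi> + card \<sigma> \<le> 2 * card \<tau> + l"
  using assms(2)
proof (induction l arbitrary: \<sigma>)
  case 0
  then show ?case using refines_refl[OF NC_partition[OF assms(1)]] by auto
next
  case (Suc l)
  then obtain \<sigma>' where s: "(\<pi>, \<sigma>') \<in> hasse_arcs n ^^ l" "(\<sigma>', \<sigma>) \<in> hasse_arcs n" by auto
  obtain \<tau> where t: "refines {1..n} \<pi> \<tau>" "refines {1..n} \<sigma>' \<tau>" "card \<pi> + card \<sigma>' \<le> 2 * card \<tau> + l"
    using Suc.IH[OF s(1)] by blast
  have NC: "\<sigma>' \<in> NC n" "\<sigma> \<in> NC n" using hasse_arcs_NC[OF s(2)] by auto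
  have pt: "partition_on {1..n} \<tau>" using t(1) by (simp add: refines_def)
  then have fint: "finite \<tau>" using finite_elements by blast
  from s(2) consider "NC_covers n \<sigma> \<sigma>'" | "NC_covers n \<sigma>' \<sigma>" unfolding hasse_arcs_iff by blast
  then show ?case
  proof cases
    case 1
    obtain A B where AB: "A \<in> \<sigma>'" "B \<in> \<sigma>'" "A \<noteq> B" "\<sigma> = merge \<sigma>' A B"
      using NC_covers_merge[OF 1] .
    have c: "Suc (card \<sigma>) = card \<sigma>'"
      unfolding AB(4) by (rule card_merge[OF NC_partition[OF NC(1)] AB(1-3) finite_NC_elem[OF NC(1)]])
    obtain S T where ST: "S \<in> \<tau>" "A \<subseteq> S" "T \<in> \<tau>" "B \<subseteq> T"
      using refines_superset[OF t(2)] AB(1,2) by metis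
    show ?thesis
    \<comment> \<open>The merger lowers \<open>card \<sigma>\<close> by one. Where \<open>S\<close>
      and \<open>T\<close> must be joined, \<open>2 * card \<tau>\<close> drops by two and the
      longer walk adds one, so the inequality is kept exactly. A splitting step, treated below,
      keeps \<open>\<tau>\<close> and adds one on both sides.\<close>
    proof (cases "S = T")
      case True
      then have "A \<union> B \<subseteq> S" using ST by blast
      then have "refines {1..n} \<sigma> \<tau>"
        unfolding AB(4) using merge_refines[OF t(2) _ ST(1)] NC_partition[OF NC(2)] AB(4) by simp
      then show ?thesis using t c by (intro exI[of _ \<tau>]) simp
    next
      case False
      have "refines {1..n} \<tau> (merge \<tau> S T)" by (rule refines_merge[OF pt ST(1,3)])
      then have r: "refines {1..n} \<pi> (merge \<tau> S T)" "refines {1..n} \<sigma>' (merge \<tau> S T)"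
        using t refines_trans by blast+
      have "A \<union> B \<subseteq> S \<union> T" "S \<union> T \<in> merge \<tau> S T" using ST by (auto simp: merge_def)
      then have "refines {1..n} \<sigma> (merge \<tau> S T)"
        unfolding AB(4) using merge_refines[OF r(2)] NC_partition[OF NC(2)] AB(4) by simp
      moreover have "Suc (card (merge \<tau> S T)) = card \<tau>"
        by (rule card_merge[OF pt ST(1,3) False fint])
      ultimately show ?thesis using t c r(1)
        by (intro exI[of _ "merge \<tau> S T"]) simp
    qed
  next
    case 2
    obtain A B where AB: "A \<in> \<sigma>" "B \<in> \<sigma>" "A \<noteq> B" "\<sigma>' = merge \<sigma> A B"
      using NC_covers_merge[OF 2] .
    have c: "Suc (card \<sigma>') = card \<sigma>"
      unfolding AB(4) by (rule card_merge[OF NC_partition[OF NC(2)] AB(1-3) finite_NC_elem[OF NC(2)]])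
    have "refines {1..n} \<sigma> \<sigma>'" using 2 by (simp add: NC_covers_def NC_less_def)
    then have "refines {1..n} \<sigma> \<tau>" using t(2) refines_trans by blast
    then show ?thesis using t c by (intro exI[of _ \<tau>]) simp
  qed
qed

section \<open>Distance \<open>n - 1\<close> and the tree condition\<close>

lemma NC_top: "n \<ge> 1 \<Longrightarrow> {{1..n}} \<in> NC n"
  by (simp add: NC_iff partition_on_space)

lemma refines_top: "n \<ge> 1 \<Longrightarrow> partition_on {1..n} \<pi> \<Longrightarrow> refines {1..n} \<pi> {{1..n :: nat}}"
  using partition_block_subset[of "{1..n}" \<pi>] by (simp add: refines_def partition_on_space)

lemma NC_bot: "(\<lambda>x. {x}) ` {1..n} \<in> NC n"
  by (auto simp: NC_iff partition_on_singletons nested_def)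

lemma refines_bot: "partition_on {1..n} \<pi> \<Longrightarrow> refines {1..n} ((\<lambda>x. {x}) ` {1..n :: nat}) \<pi>"
  using partition_ex_block[of "{1..n}" \<pi>] by (auto simp: refines_def partition_on_singletons)

lemma card_bot: "card ((\<lambda>x. {x}) ` {1..n}) = n"
  by (simp add: card_image)

lemma NC_two_blocks:
  assumes "1 \<le> i" "i < j" "j \<le> n"
  shows "{{i<..j}, {1..n} - {i<..j}} \<in> NC n"
proof -
  have "j \<in> {i<..j}" "i \<in> {1..n} - {i<..j}" using assms by auto
  then have "{} \<notin> {{i<..j}, {1..n} - {i<..j}}" by (metis empty_iff insert_iff)
  moreover have "\<Union> {{i<..j}, {1..n} - {i<..j}} = {1..n}" using assms by auto
  ultimately have "partition_on {1..n} {{i<..j}, {1..n} - {i<..j}}"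
    by (intro partition_onI) (auto simp: disjnt_def)
  moreover have "nested ({1..n} - {i<..j}) {i<..j}" by (auto simp: nested_def)
  moreover then have "nested {i<..j} ({1..n} - {i<..j})" by (rule nested_sym) auto
  ultimately show ?thesis by (simp add: NC_iff)
qed

lemma refines_two_blocks:
  assumes "partition_on {1..n} \<pi>" "saturated \<pi> X" "partition_on {1..n} {X, {1..n} - X}"
  shows "refines {1..n} \<pi> {X, {1..n} - X}"
  unfolding refines_def
proof (intro conjI ballI assms(1,3))
  fix B assume B: "B \<in> \<pi>"
  then have "B \<subseteq> {1..n}" by (rule partition_block_subset[OF assms(1)])
  then show "\<exists>Y\<in>{X, {1..n} - X}. B \<subseteq> Y" using B assms(2) by (auto simp: saturated_def)
qed

text \<open>The walk through the coarsest partition has length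
  \<open>card \<pi> + card \<rho> - 2\<close>, the one through the finest
  \<open>2 * n - card \<pi> - card \<rho>\<close>; neither is below \<open>n - 1\<close> only if the
  sum is \<open>n + 1\<close>.\<close>

lemma d_H_eq_imp_card:
  assumes "n \<ge> 1" "\<pi> \<in> NC n" "\<rho> \<in> NC n" "d_H n \<pi> \<rho> = ereal (real (n - 1))"
  shows "card \<pi> + card \<rho> = n + 1"
proof -
  note p = NC_partition[OF assms(2)] NC_partition[OF assms(3)]
  have top: "card {{1..n}} \<le> card \<pi>" "card {{1..n}} \<le> card \<rho>"
    using refines_card_le refines_top[OF assms(1)] p finite_NC_elem assms(2,3) by blast+
  have bot: "card \<pi> \<le> n" "card \<rho> \<le> n"
    using refines_card_le[OF refines_bot[OF p(1)]] refines_card_le[OF refines_bot[OF p(2)]]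
    unfolding card_bot by simp_all
  have "d_H n \<pi> \<rho> \<le> ereal (real ((card \<pi> - card {{1..n}}) + (card \<rho> - card {{1..n}})))"
    by (rule d_H_le_coarser[OF assms(2,3) NC_top[OF assms(1)] refines_top[OF assms(1) p(1)]
          refines_top[OF assms(1) p(2)]])
  then have "n - 1 \<le> (card \<pi> - 1) + (card \<rho> - 1)" using assms(4) by simp
  moreover have "d_H n \<pi> \<rho> \<le> ereal (real ((n - card \<pi>) + (n - card \<rho>)))"
    using d_H_le_finer[OF assms(2,3) NC_bot refines_bot[OF p(1)] refines_bot[OF p(2)]]
    by (simp only: card_bot)
  then have "n - 1 \<le> (n - card \<pi>) + (n - card \<rho>)" using assms(4) by simp
  ultimately show ?thesis using top bot assms(1) by simp
qed

text \<open>Otherwise a common coarsening with two blocks bounds the distance by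
  \<open>card \<pi> + card \<rho> - 4 = n - 3\<close>.\<close>

lemma d_H_eq_imp_no_saturated_interval:
  assumes "\<pi> \<in> NC n" "\<rho> \<in> NC n" "d_H n \<pi> \<rho> = ereal (real (n - 1))"
    and ij: "1 \<le> i" "i < j" "j \<le> n" and sat: "saturated \<pi> {i<..j}"
  shows "\<not> saturated \<rho> {i<..j}"
proof
  assume sat': "saturated \<rho> {i<..j}"
  let ?\<sigma> = "{{i<..j}, {1..n} - {i<..j}}"
  note p = NC_partition[OF assms(1)] NC_partition[OF assms(2)]
  have NC: "?\<sigma> \<in> NC n" by (rule NC_two_blocks[OF ij])
  have r: "refines {1..n} \<pi> ?\<sigma>" "refines {1..n} \<rho> ?\<sigma>"
    using refines_two_blocks NC_partition[OF NC] p sat sat' by blast+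
  have "i \<in> {1..n} - {i<..j}" "i \<notin> {i<..j}" using ij by auto
  then have c: "card ?\<sigma> = 2" by (metis card_2_iff)
  have le: "2 \<le> card \<pi>" "2 \<le> card \<rho>"
    using refines_card_le[OF r(1)] refines_card_le[OF r(2)] finite_NC_elem assms(1,2) c by auto
  have "d_H n \<pi> \<rho> \<le> ereal (real ((card \<pi> - 2) + (card \<rho> - 2)))"
    using d_H_le_coarser[OF assms(1,2) NC r] c by simp
  then have "n - 1 \<le> (card \<pi> - 2) + (card \<rho> - 2)" using assms(3) by simp
  moreover have "card \<pi> + card \<rho> = n + 1"
    using d_H_eq_imp_card[OF _ assms(1-3)] ij by simp
  ultimately show False using le by simp
qed

text \<open>By \<open>conn\<close>, a common coarsening has only one block, so the estimate for
  walks gives length at least \<open>n + 1 - 2\<close>; the walk through the coarsest partition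
  attains it.\<close>

lemma d_H_eqI:
  assumes n: "n \<ge> 1" and NC: "\<pi> \<in> NC n" "\<rho> \<in> NC n" and card: "card \<pi> + card \<rho> = n + 1"
    and conn: "\<And>Z. Z \<subseteq> {1..n} \<Longrightarrow> Z \<noteq> {} \<Longrightarrow> saturated \<pi> Z \<Longrightarrow> saturated \<rho> Z \<Longrightarrow> Z = {1..n}"
  shows "d_H n \<pi> \<rho> = ereal (real (n - 1))"
proof (rule antisym)
  note p = NC_partition[OF NC(1)] NC_partition[OF NC(2)]
  have top: "card {{1..n}} \<le> card \<pi>" "card {{1..n}} \<le> card \<rho>"
    using refines_card_le refines_top[OF n] p finite_NC_elem NC by blast+
  have "d_H n \<pi> \<rho> \<le> ereal (real ((card \<pi> - card {{1..n}}) + (card \<rho> - card {{1..n}})))"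
    by (rule d_H_le_coarser[OF NC NC_top[OF n] refines_top[OF n p(1)] refines_top[OF n p(2)]])
  also have "(card \<pi> - card {{1..n}}) + (card \<rho> - card {{1..n}}) = n - 1"
    using top card by simp
  finally show "d_H n \<pi> \<rho> \<le> ereal (real (n - 1))" .
  show "ereal (real (n - 1)) \<le> d_H n \<pi> \<rho>"
  proof (rule d_H_ge)
    fix l assume "(\<pi>, \<rho>) \<in> hasse_arcs n ^^ l"
    then obtain \<tau> where t: "refines {1..n} \<pi> \<tau>" "refines {1..n} \<rho> \<tau>" "card \<pi> + card \<rho> \<le> 2 * card \<tau> + l"
      using relpow_common_coarsening[OF NC(1)] by blast
    have pt: "partition_on {1..n} \<tau>" using t(1) by (simp add: refines_def)
    have sat: "saturated \<sigma> T" if r: "refines {1..n} \<sigma> \<tau>" and T: "T \<in> \<tau>" for \<sigma> T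
      unfolding saturated_def
    proof
      fix B assume "B \<in> \<sigma>"
      then obtain S where S: "S \<in> \<tau>" "B \<subseteq> S" using refines_superset[OF r] by blast
      show "B \<subseteq> T \<or> B \<inter> T = {}"
        using S partition_disjoint[OF pt S(1) T] by blast
    qed
    have "T = {1..n}" if "T \<in> \<tau>" for T
      using conn[of T] sat[OF t(1) that] sat[OF t(2) that] partition_block_subset[OF pt that]
        partition_onD3[OF pt] that by metis
    then have "\<tau> \<subseteq> {{1..n}}" by blast
    then have "card \<tau> \<le> 1" using card_mono[of "{{1..n}}" \<tau>] by simp
    then show "n - 1 \<le> l" using t(3) card by simp
  qed
qed

text \<open>Among the pairs of points of a block of \<open>\<rho>\<close> that enclose a point on the other side of
  \<open>Z\<close>, a closest one encloses a \<open>\<rho>\<close>-saturated run; without such pairs the first run of \<open>{1..n}\<close>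
  is saturated.\<close>

lemma separates_connected:
  assumes NC: "\<rho> \<in> NC n" and sep: "separates n D \<rho>"
    and Z: "Z \<subseteq> {1..n}" "Z \<noteq> {}" and sat: "saturated \<rho> Z"
    and adj: "\<And>i. i \<in> {1..<n} - D \<Longrightarrow> i \<in> Z \<longleftrightarrow> Suc i \<in> Z"
  shows "Z = {1..n}"
proof (rule ccontr)
  assume ne: "Z \<noteq> {1..n}"
  note p = NC_partition[OF NC]
  have DI: "i \<in> D" if "1 \<le> i" "i < n" "(i \<in> Z) \<noteq> (Suc i \<in> Z)" for i
    using adj[of i] that by auto
  have same: "x \<in> Z \<longleftrightarrow> y \<in> Z" if "B \<in> \<rho>" "x \<in> B" "y \<in> B" for B x y
    using sat that unfolding saturated_def by blast
  define bad where "bad x y \<longleftrightarrow> x < y \<and> (\<exists>B\<in>\<rho>. x \<in> B \<and> y \<in> B) \<and>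
      (\<exists>k. x < k \<and> k < y \<and> (k \<in> Z) \<noteq> (x \<in> Z))" for x y
  have nobad: "\<not> bad x y" for x y
  proof (induction "y - x" arbitrary: x y rule: less_induct)
    case less
    show ?case
    proof
      assume b: "bad x y"
      then obtain B k where B: "B \<in> \<rho>" "x \<in> B" "y \<in> B" and k: "x < k" "k < y" "(k \<in> Z) \<noteq> (x \<in> Z)"
        unfolding bad_def by blast
      have xy: "1 \<le> x" "y \<le> n" using NC_block_bounds[OF NC B(1)] B by auto
      have xyZ: "x \<in> Z \<longleftrightarrow> y \<in> Z" using same[OF B] .
      \<comment> \<open>Read membership in \<open>Z\<close> as a colour. The points \<open>i\<close>
        and \<open>Suc j\<close> are the nearest ones on either side of \<open>k\<close> with the
        colour of \<open>x\<close>, so \<open>{i<..j}\<close> is a maximal run of the other colour.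
        Colours change only at cuts, hence \<open>i\<close> and \<open>j\<close> lie in
        \<open>D\<close>.\<close>
      define I where "I = {t. x \<le> t \<and> t < k \<and> (t \<in> Z) = (x \<in> Z)}"
      define J where "J = {t. k < t \<and> t \<le> y \<and> (t \<in> Z) = (x \<in> Z)}"
      define i where "i = Max I"
      define j where "j = Min J - 1"
      have fI: "finite I" and fJ: "finite J" by (simp_all add: I_def J_def)
      have "x \<in> I" using k by (simp add: I_def)
      then have iI: "i \<in> I" unfolding i_def using fI by (metis Max_in empty_iff)
      have "y \<in> J" using k xyZ by (simp add: J_def)
      then have "Min J \<in> J" using fJ by (metis Min_in empty_iff)
      moreover then have "Suc j = Min J" by (simp add: j_def J_def)
      ultimately have jJ: "Suc j \<in> J" by simp
      have i: "x \<le> i" "i < k" "(i \<in> Z) = (x \<in> Z)" using iI by (auto simp: I_def)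
      have j: "k \<le> j" "Suc j \<le> y" "(Suc j \<in> Z) = (x \<in> Z)" using jJ by (auto simp: J_def)
      have run: "(t \<in> Z) \<noteq> (x \<in> Z)" if "i < t" "t \<le> j" for t
      proof
        assume *: "(t \<in> Z) = (x \<in> Z)"
        then consider "t < k" | "t > k" using k by (metis nat_neq_iff)
        then show False
        proof cases
          case 1
          then have "t \<in> I" using * that i by (simp add: I_def)
          then have "t \<le> i" unfolding i_def using fI by simp
          then show False using that by simp
        next
          case 2
          then have "t \<in> J" using * that j by (simp add: J_def)
          then have "Suc j \<le> t" unfolding \<open>Suc j = Min J\<close> using fJ by simp
          then show False using that by simp
        qed
      qed
      have "i \<in> D" using DI[of i] run[of "Suc i"] i j xy k by auto
      moreover have "j \<in> D" using DI[of j] run[of j] i j xy k by auto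
      moreover have "saturated \<rho> {i<..j}"
        unfolding saturated_def
      proof (intro ballI, rule ccontr)
        fix C assume C: "C \<in> \<rho>" and "\<not> (C \<subseteq> {i<..j} \<or> C \<inter> {i<..j} = {})"
        then obtain z z' where z: "z \<in> C" "i < z" "z \<le> j" and z': "z' \<in> C" "z' \<notin> {i<..j}"
          by (metis disjoint_iff greaterThanAtMost_iff subsetI)
        \<comment> \<open>The block \<open>C\<close> has the colour of the run and lies between
          \<open>x\<close> and \<open>y\<close>. Leaving the run, it jumps over \<open>i\<close> or
          \<open>Suc j\<close>, so two of its points form a bad pair closer together than
          \<open>x\<close> and \<open>y\<close>.\<close>
        have zZ: "(z \<in> Z) \<noteq> (x \<in> Z)" using run z by blast
        then have z'Z: "(z' \<in> Z) \<noteq> (x \<in> Z)" using same[OF C z(1) z'(1)] by simp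
        have "C \<noteq> B" using same[OF B(1) B(2), of z] zZ z(1) by blast
        then have "nested C B" using NC_nestedD[OF NC C B(1)] by blast
        then have enc: "x < z'" "z' < y" using nestedD[of C B z z' x y] z z' B i j by auto
        show False
        proof (cases "z' \<le> i")
          case True
          then have "z' < i" using i z'Z by (metis le_neq_implies_less)
          then have "bad z' z" using C z z' i z'Z unfolding bad_def by (meson order_less_trans)
          moreover have "z - z' < y - x" using enc z j by simp
          ultimately show False using less by blast
        next
          case False
          then have "Suc j \<le> z'" using z' by simp
          then have "Suc j < z'" using j z'Z by (metis le_neq_implies_less)
          moreover have "z < Suc j" using z by simp
          ultimately have "bad z z'" using C z z' j zZ unfolding bad_def by (meson order_less_trans)
          moreover have "z' - z < y - x" using enc z i by simp
          ultimately show False using less by blast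
        qed
      qed
      ultimately show False using sep i j unfolding separates_def
        by (metis insertI2 le_less_trans less_le_trans order_less_le_trans)
    qed
  qed
  have "\<exists>i. 1 \<le> i \<and> i < n \<and> (i \<in> Z) \<noteq> (Suc i \<in> Z)"
  proof (rule ccontr)
    assume *: "\<not> ?thesis"
    have const: "t \<in> Z \<longleftrightarrow> 1 \<in> Z" if "1 \<le> t" "t \<le> n" for t
      using that
    proof (induction t rule: dec_induct)
      case (step t)
      then show ?case using * by (metis Suc_le_lessD Suc_leD)
    qed simp
    have bounds: "1 \<le> t \<and> t \<le> n" if "t \<in> Z" for t using that Z(1) by auto
    show False
    proof (cases "1 \<in> Z")
      case True
      then have "{1..n} \<subseteq> Z" using const by auto
      then show False using Z(1) ne by blast
    next
      case False
      then show False using Z(2) const bounds by blast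
    qed
  qed
  \<comment> \<open>At the first colour change, a block leading from \<open>{1..i}\<close> to beyond
    \<open>i\<close> would have the colour of \<open>i\<close> and enclose \<open>Suc i\<close>,
    which has the other one: a bad pair. So \<open>{i<..n}\<close> is saturated, and the cut
    \<open>i\<close> is not separated from \<open>n\<close>.\<close>
  define i where "i = (LEAST i. 1 \<le> i \<and> i < n \<and> (i \<in> Z) \<noteq> (Suc i \<in> Z))"
  have i: "1 \<le> i" "i < n" "(i \<in> Z) \<noteq> (Suc i \<in> Z)"
    using LeastI_ex[OF \<open>\<exists>i. _ i\<close>] unfolding i_def by auto
  have least: "(t \<in> Z) = (Suc t \<in> Z)" if "1 \<le> t" "t < i" for t
    using not_less_Least[of t "\<lambda>i. 1 \<le> i \<and> i < n \<and> (i \<in> Z) \<noteq> (Suc i \<in> Z)"] that i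
    unfolding i_def[symmetric] by auto
  have first: "t \<in> Z \<longleftrightarrow> i \<in> Z" if "1 \<le> t" "t \<le> i" for t
    using that(2,1)
  proof (induction t rule: inc_induct)
    case (step t)
    then show ?case using least[of t] by simp
  qed simp
  have "saturated \<rho> {i<..n}"
    unfolding saturated_def
  proof (intro ballI, rule ccontr)
    fix C assume C: "C \<in> \<rho>" and "\<not> (C \<subseteq> {i<..n} \<or> C \<inter> {i<..n} = {})"
    then obtain z z' where z: "z \<in> C" "i < z" "z \<le> n" and z': "z' \<in> C" "z' \<notin> {i<..n}"
      by (metis disjoint_iff greaterThanAtMost_iff subsetI)
    have b: "1 \<le> z'" "z' \<le> i" using NC_block_bounds[OF NC C z'(1)] z'(2) by auto
    have col: "z' \<in> Z \<longleftrightarrow> i \<in> Z" "z \<in> Z \<longleftrightarrow> i \<in> Z" using first[OF b] same[OF C z(1) z'(1)] by auto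
    then have "Suc i < z" using z i by (metis Suc_leI le_neq_implies_less)
    moreover have "z' < Suc i" "(Suc i \<in> Z) \<noteq> (z' \<in> Z)" using b i col by auto
    ultimately have "bad z' z" unfolding bad_def using C z(1) z'(1)
      by (intro conjI bexI[of _ C] exI[of _ "Suc i"]) simp_all
    then show False using nobad by blast
  qed
  moreover have "i \<in> D" by (rule DI[OF i])
  ultimately show False using sep i unfolding separates_def by blast
qed

section \<open>Interval partitions\<close>

text \<open>The interval partition with the set \<open>D\<close> of right block ends other than \<open>n\<close>.\<close>

definition ipart_block :: "nat \<Rightarrow> nat set \<Rightarrow> nat \<Rightarrow> nat set" where
  "ipart_block n D x = {y \<in> {1..n}. \<forall>d\<in>D. d < x \<longleftrightarrow> d < y}"

lemma ipart_blockD: "y \<in> ipart_block n D x \<Longrightarrow> d \<in> D \<Longrightarrow> d < x \<longleftrightarrow> d < y"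
  by (simp add: ipart_block_def)

definition ipart :: "nat \<Rightarrow> nat set \<Rightarrow> nat set set" where
  "ipart n D = ipart_block n D ` {1..n}"

lemma ipart_block_self: "x \<in> {1..n} \<Longrightarrow> x \<in> ipart_block n D x"
  by (simp add: ipart_block_def)

lemma ipart_block_eq: "y \<in> ipart_block n D x \<Longrightarrow> ipart_block n D y = ipart_block n D x"
  by (auto simp: ipart_block_def)

lemma partition_on_ipart: "partition_on {1..n} (ipart n D)"
proof (rule partition_onI)
  show "\<Union> (ipart n D) = {1..n}"
    using ipart_block_self by (auto simp: ipart_def ipart_block_def)
  show "{} \<notin> ipart n D" using ipart_block_self by (fastforce simp: ipart_def)
  fix B C assume "B \<in> ipart n D" "C \<in> ipart n D" "B \<noteq> C"
  then obtain x y where "B = ipart_block n D x" "C = ipart_block n D y" by (auto simp: ipart_def)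
  then show "disjnt B C" using ipart_block_eq \<open>B \<noteq> C\<close> unfolding disjnt_iff by metis
qed

lemma ipart_interval:
  assumes "B \<in> ipart n D"
  shows "\<exists>p\<in>{1..n}. \<exists>q\<in>{1..n}. p \<le> q \<and> B = {p..q}"
proof -
  obtain x where x: "x \<in> {1..n}" "B = ipart_block n D x" using assms by (auto simp: ipart_def)
  have sub: "B \<subseteq> {1..n}" unfolding x(2) ipart_block_def by blast
  then have fin: "finite B" by (rule finite_subset) simp
  have ne: "B \<noteq> {}" using ipart_block_self x by blast
  have M: "Min B \<in> B" "Max B \<in> B" using fin ne by simp_all
  have between: "z \<in> B" if z: "Min B \<le> z" "z \<le> Max B" for z
  proof -
    have "z \<in> {1..n}" using z M sub by (meson atLeastAtMost_iff in_mono le_trans)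
    moreover have "d < x \<longleftrightarrow> d < z" if "d \<in> D" for d
    proof -
      have "d < x \<longleftrightarrow> d < y" if "y \<in> B" for y
        using ipart_blockD[OF _ \<open>d \<in> D\<close>] that x(2) by blast
      then have "d < x \<longleftrightarrow> d < Min B" "d < x \<longleftrightarrow> d < Max B" using M by blast+
      then show ?thesis using z by auto
    qed
    ultimately show ?thesis by (simp add: x(2) ipart_block_def)
  qed
  have "B = {Min B..Max B}"
  proof (rule set_eqI)
    fix z show "z \<in> B \<longleftrightarrow> z \<in> {Min B..Max B}"
      using between[of z] Min_le[OF fin, of z] Max_ge[OF fin, of z] unfolding atLeastAtMost_iff by blast
  qed
  moreover have "Min B \<le> Max B" using fin M by simp
  ultimately show ?thesis using M sub by blast
qed

lemma intervals_Int_part: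
  assumes "partition_on {1..n} \<pi>" "\<And>B. B \<in> \<pi> \<Longrightarrow> \<exists>p\<in>{1..n}. \<exists>q\<in>{1..n}. p \<le> q \<and> B = {p..q}"
  shows "\<pi> \<in> Int_part n"
proof -
  have "nested V W" if VW: "V \<in> \<pi>" "W \<in> \<pi>" "V \<noteq> W" for V W
    unfolding nested_def
  proof (intro ballI impI)
    fix a c k l assume H: "a \<in> V" "c \<in> V" "k \<in> W" "l \<in> W" "k < a \<and> a < l"
    obtain p q where "W = {p..q}" using assms(2)[OF VW(2)] by blast
    then have "a \<in> W" using H by auto
    then show "k < c \<and> c < l" using H(1) partition_disjoint[OF assms(1) VW] by blast
  qed
  then show ?thesis using assms by (simp add: Int_part_def NC_iff)
qed

lemma ipart_Int_part: "ipart n D \<in> Int_part n"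
  by (rule intervals_Int_part[OF partition_on_ipart ipart_interval])

lemma ipart_NC: "ipart n D \<in> NC n"
  using ipart_Int_part by (simp add: Int_part_def)

lemma ipart_block_step:
  assumes "1 \<le> i" "i < n"
  shows "Suc i \<in> ipart_block n D i \<longleftrightarrow> i \<notin> D"
  using assms by (auto simp: ipart_block_def less_Suc_eq)

text \<open>The cuts are recovered as the points whose successor lies in another block.\<close>

lemma ipart_inj: "inj_on (ipart n) (Pow {1..<n})"
proof (rule inj_onI)
  have *: "D = {i \<in> {1..<n}. \<not> (\<exists>B\<in>ipart n D. i \<in> B \<and> Suc i \<in> B)}" if D: "D \<in> Pow {1..<n}" for D
  proof -
    have "i \<in> D \<longleftrightarrow> \<not> (\<exists>B\<in>ipart n D. i \<in> B \<and> Suc i \<in> B)" if i: "i \<in> {1..<n}" for i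
    proof -
      have I: "ipart_block n D i \<in> ipart n D" "i \<in> ipart_block n D i"
        using i ipart_block_self by (auto simp: ipart_def)
      then have "(\<exists>B\<in>ipart n D. i \<in> B \<and> Suc i \<in> B) \<longleftrightarrow> Suc i \<in> ipart_block n D i"
        using partition_block_eq[OF partition_on_ipart _ I(1) _ I(2)] by blast
      then show ?thesis using ipart_block_step i by simp
    qed
    then show ?thesis using D by auto
  qed
  fix D E assume DE: "D \<in> Pow {1..<n}" "E \<in> Pow {1..<n}" and eq: "ipart n D = ipart n E"
  show "D = E" by (subst *[OF DE(1)], subst *[OF DE(2)]) (simp only: eq)
qed

lemma Int_part_ipart:
  assumes "\<pi> \<in> Int_part n"
  obtains D where "D \<subseteq> {1..<n}" "\<pi> = ipart n D"
proof -
  have NC: "\<pi> \<in> NC n" and int: "\<And>B. B \<in> \<pi> \<Longrightarrow> \<exists>p\<in>{1..n}. \<exists>q\<in>{1..n}. p \<le> q \<and> B = {p..q}"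
    using assms by (auto simp: Int_part_def)
  note p = NC_partition[OF NC]
  define D where "D = {i \<in> {1..<n}. \<not> (\<exists>B\<in>\<pi>. i \<in> B \<and> Suc i \<in> B)}"
  have block: "ipart_block n D x = B" if B: "B \<in> \<pi>" "x \<in> B" for B x
  proof -
    obtain a b where ab: "1 \<le> a" "b \<le> n" "B = {a..b}" using int[OF B(1)] by auto
    have x: "a \<le> x" "x \<le> b" using B(2) ab(3) by auto
    \<comment> \<open>The cuts next to the block \<open>{a..b}\<close> are \<open>a - 1\<close> and
      \<open>b\<close>, as far as they lie in \<open>{1..<n}\<close>, and none lies between them; so
      comparing cuts cuts out exactly \<open>{a..b}\<close>.\<close>
    have inner: "d \<notin> D" if "a \<le> d" "d < b" for d
    proof -
      have "d \<in> B" "Suc d \<in> B" using that ab(3) by auto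
      then show ?thesis using B(1) unfolding D_def by blast
    qed
    have end_b: "b \<in> D" if "b < n"
    proof -
      have "\<not> (b \<in> C \<and> Suc b \<in> C)" if "C \<in> \<pi>" for C
        using partition_block_eq[OF p that B(1), of b] x ab(3) by auto
      then show ?thesis using that x ab by (auto simp: D_def)
    qed
    have end_a: "a - 1 \<in> D" if "1 < a"
    proof -
      have "\<not> (a - 1 \<in> C \<and> Suc (a - 1) \<in> C)" if "C \<in> \<pi>" for C
        using partition_block_eq[OF p that B(1), of a] x ab(3) \<open>1 < a\<close> by auto
      then show ?thesis using that x ab by (auto simp: D_def)
    qed
    show ?thesis
    proof (rule set_eqI)
      fix y
      show "y \<in> ipart_block n D x \<longleftrightarrow> y \<in> B"
      proof
        assume "y \<in> B"
        then have y: "a \<le> y" "y \<le> b" using ab(3) by auto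
        have "d < x \<longleftrightarrow> d < y" if "d \<in> D" for d
          using inner[of d] that x y by (meson le_less_trans less_le_trans not_le)
        then show "y \<in> ipart_block n D x" using y ab by (auto simp: ipart_block_def)
      next
        assume "y \<in> ipart_block n D x"
        then have y: "1 \<le> y" "y \<le> n" "\<And>d. d \<in> D \<Longrightarrow> d < x \<longleftrightarrow> d < y" by (auto simp: ipart_block_def)
        have "y \<le> b" using y(3)[OF end_b] x y by (meson leD le_less_trans not_le less_le_trans)
        moreover have "a \<le> y"
        proof (rule ccontr)
          assume "\<not> a \<le> y"
          then show False using y(3)[OF end_a] x y by auto
        qed
        ultimately show "y \<in> B" using ab(3) by simp
      qed
    qed
  qed
  have "\<pi> = ipart n D"
  proof (intro equalityI subsetI)
    fix B assume B: "B \<in> \<pi>"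
    then obtain x where x: "x \<in> B" using partition_onD3[OF p] by (metis ex_in_conv)
    then have "x \<in> {1..n}" using partition_block_subset[OF p B] by blast
    then show "B \<in> ipart n D" unfolding ipart_def using block[OF B x] by blast
  next
    fix B assume "B \<in> ipart n D"
    then obtain x where x: "x \<in> {1..n}" "B = ipart_block n D x" by (auto simp: ipart_def)
    then obtain C where C: "C \<in> \<pi>" "x \<in> C" using partition_ex_block[OF p] by blast
    then show "B \<in> \<pi>" using block[OF C] x(2) by simp
  qed
  moreover have "D \<subseteq> {1..<n}" unfolding D_def by (rule Collect_restrict)
  ultimately show thesis using that by blast
qed

text \<open>Blocks are counted by their right ends, the elements of \<open>insert n D\<close>; the
  right end of the block of \<open>x\<close> is the least of these that is at least
  \<open>x\<close>.\<close>

lemma card_ipart: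
  assumes n: "n \<ge> 1" and D: "D \<subseteq> {1..<n}"
  shows "card (ipart n D) = Suc (card D)"
proof -
  have fin: "finite D" using D finite_subset by blast
  have nD: "n \<notin> D" using D by auto
  have ends: "insert n D \<subseteq> {1..n}" using D n by auto
  have "inj_on (ipart_block n D) (insert n D)"
  proof (rule linorder_inj_onI')
    fix c c' assume c: "c < c'" "c \<in> insert n D" "c' \<in> insert n D"
    then have "c \<in> D" using D by fastforce
    then have "c' \<notin> ipart_block n D c" using c by (auto simp: ipart_block_def)
    moreover have "c' \<in> ipart_block n D c'" using ipart_block_self ends c by blast
    ultimately show "ipart_block n D c \<noteq> ipart_block n D c'" by auto
  qed
  moreover have "ipart_block n D ` insert n D = ipart n D"
  proof (intro equalityI subsetI)
    fix B assume "B \<in> ipart n D"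
    then obtain x where x: "x \<in> {1..n}" "B = ipart_block n D x" by (auto simp: ipart_def)
    define C where "C = {c \<in> insert n D. x \<le> c}"
    have "finite C" "C \<noteq> {}" using fin x by (auto simp: C_def)
    then have M: "Min C \<in> C" and least: "\<And>c. c \<in> C \<Longrightarrow> Min C \<le> c" by simp_all
    have "d < x \<longleftrightarrow> d < Min C" if "d \<in> D" for d
    proof -
      have "d < x" if "d < Min C"
        using least[of d] that \<open>d \<in> D\<close> by (auto simp: C_def not_less[symmetric])
      moreover have "x \<le> Min C" using M by (simp add: C_def)
      ultimately show ?thesis by linarith
    qed
    moreover have "Min C \<in> insert n D" using M by (simp add: C_def)
    moreover then have "Min C \<in> {1..n}" using ends by blast
    ultimately have "Min C \<in> ipart_block n D x" by (simp add: ipart_block_def)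
    then have "B = ipart_block n D (Min C)" using ipart_block_eq x(2) by simp
    then show "B \<in> ipart_block n D ` insert n D" using \<open>Min C \<in> insert n D\<close> by blast
  qed (use ends in \<open>auto simp: ipart_def\<close>)
  ultimately have "card (ipart n D) = card (insert n D)" by (metis card_image)
  then show ?thesis using fin nD by simp
qed

lemma saturated_ipart_interval:
  assumes "i \<in> D" "j \<in> insert n D" "i < j"
  shows "saturated (ipart n D) {i<..j}"
  unfolding saturated_def
proof
  fix B assume "B \<in> ipart n D"
  then obtain x where x: "B = ipart_block n D x" by (auto simp: ipart_def)
  have "y \<in> {i<..j} \<longleftrightarrow> i < x \<and> (j = n \<or> x \<le> j)" if "y \<in> B" for y
  proof -
    have "y \<le> n" using that unfolding x ipart_block_def by simp
    moreover have "i < x \<longleftrightarrow> i < y" using ipart_blockD[OF _ assms(1)] that x by blast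
    moreover have "j < x \<longleftrightarrow> j < y" if "j \<noteq> n"
      using ipart_blockD[of y n D x j] \<open>y \<in> B\<close> assms(2) that x by blast
    ultimately show ?thesis by fastforce
  qed
  then show "B \<subseteq> {i<..j} \<or> B \<inter> {i<..j} = {}" by blast
qed

lemma d_H_ipart_iff:
  assumes n: "n \<ge> 1" and D: "D \<subseteq> {1..<n}" and NC: "\<rho> \<in> NC n"
  shows "d_H n (ipart n D) \<rho> = ereal (real (n - 1)) \<longleftrightarrow>
           (\<rho>, D) \<in> cut_pairs n \<and> card D + card \<rho> = n"
proof
  assume d: "d_H n (ipart n D) \<rho> = ereal (real (n - 1))"
  have "separates n D \<rho>"
    unfolding separates_def
  proof (intro ballI impI)
    fix i j assume ij: "i \<in> D" "j \<in> insert n D" "i < j"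
    have "1 \<le> i" "j \<le> n" using ij D by fastforce+
    then show "\<not> saturated \<rho> {i<..j}"
      using d_H_eq_imp_no_saturated_interval[OF ipart_NC NC d _ ij(3)] saturated_ipart_interval[OF ij]
      by blast
  qed
  moreover have "card (ipart n D) + card \<rho> = n + 1"
    by (rule d_H_eq_imp_card[OF n ipart_NC NC d])
  ultimately show "(\<rho>, D) \<in> cut_pairs n \<and> card D + card \<rho> = n"
    using D NC card_ipart[OF n D] by (simp add: cut_pairs_def)
next
  assume R: "(\<rho>, D) \<in> cut_pairs n \<and> card D + card \<rho> = n"
  show "d_H n (ipart n D) \<rho> = ereal (real (n - 1))"
  proof (rule d_H_eqI[OF n ipart_NC NC])
    show "card (ipart n D) + card \<rho> = n + 1" using R card_ipart[OF n D] by simp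
    fix Z assume Z: "Z \<subseteq> {1..n}" "Z \<noteq> {}" "saturated (ipart n D) Z" "saturated \<rho> Z"
    \<comment> \<open>Neighbours not separated by a cut share an interval, so membership in
      \<open>Z\<close> changes only at cuts.\<close>
    have "i \<in> Z \<longleftrightarrow> Suc i \<in> Z" if i: "i \<in> {1..<n} - D" for i
    proof -
      have "ipart_block n D i \<in> ipart n D" "i \<in> ipart_block n D i" "Suc i \<in> ipart_block n D i"
        using i ipart_block_self ipart_block_step by (auto simp: ipart_def)
      then show ?thesis using Z(3) unfolding saturated_def by blast
    qed
    then show "Z = {1..n}"
      using separates_connected[OF NC _ Z(1,2,4)] R by (auto simp: cut_pairs_def)
  qed
qed

section \<open>Assembling the count\<close>

lemma M1_bar_eq:
  assumes "n \<ge> 1"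
  shows "M1_bar n = (\<lambda>(\<rho>, D). (ipart n D, \<rho>)) ` {(\<rho>, D) \<in> cut_pairs n. card D + card \<rho> = n}"
proof (intro equalityI subsetI)
  fix x assume "x \<in> M1_bar n"
  then obtain \<pi> \<rho> where x: "x = (\<pi>, \<rho>)" "\<pi> \<in> Int_part n" "\<rho> \<in> NC n" "d_H n \<pi> \<rho> = ereal (real (n - 1))"
    by (auto simp: M1_bar_def)
  obtain D where D: "D \<subseteq> {1..<n}" "\<pi> = ipart n D" using Int_part_ipart[OF x(2)] .
  have "(\<rho>, D) \<in> {(\<rho>, D) \<in> cut_pairs n. card D + card \<rho> = n}"
    using d_H_ipart_iff[OF assms D(1) x(3)] x(4) D(2) by simp
  then show "x \<in> (\<lambda>(\<rho>, D). (ipart n D, \<rho>)) ` {(\<rho>, D) \<in> cut_pairs n. card D + card \<rho> = n}"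
    using x(1) D(2) by force
next
  fix x assume "x \<in> (\<lambda>(\<rho>, D). (ipart n D, \<rho>)) ` {(\<rho>, D) \<in> cut_pairs n. card D + card \<rho> = n}"
  then obtain \<rho> D where x: "x = (ipart n D, \<rho>)" "(\<rho>, D) \<in> cut_pairs n" "card D + card \<rho> = n"
    by auto
  then have "D \<subseteq> {1..<n}" "\<rho> \<in> NC n" by (simp_all add: cut_pairs_def)
  then show "x \<in> M1_bar n"
    using d_H_ipart_iff[OF assms] x ipart_Int_part by (simp add: M1_bar_def)
qed

lemma card_M1_bar_fixed:
  assumes m: "1 \<le> m" "m \<le> n"
  shows "n * card {(\<pi>, \<rho>) \<in> M1_bar n. card \<pi> = m} = (n choose (m - 1)) * ((n + m - 1) choose (n - m))"
proof -
  have n: "n \<ge> 1" using m by simp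
  define f where "f = (\<lambda>(\<rho> :: nat set set, D). (ipart n D, \<rho>))"
  define T where "T = {(\<rho>, D) \<in> cut_pairs n. card D = m - 1 \<and> card \<rho> + (m - 1) = n}"
  have sub: "D \<in> Pow {1..<n}" if "(\<rho>, D) \<in> cut_pairs n" for \<rho> D
    using that by (simp add: cut_pairs_def)
  have cip: "card (ipart n D) = m \<longleftrightarrow> card D = m - 1" if "(\<rho>, D) \<in> cut_pairs n" for \<rho> D
    using card_ipart[OF n, of D] sub[OF that] m by auto
  have "{(\<pi>, \<rho>) \<in> M1_bar n. card \<pi> = m} = f ` T"
  proof (intro equalityI subsetI)
    fix x assume "x \<in> {(\<pi>, \<rho>) \<in> M1_bar n. card \<pi> = m}"
    then obtain \<rho> D where x: "x = (ipart n D, \<rho>)" "(\<rho>, D) \<in> cut_pairs n" "card D + card \<rho> = n"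
      "card (ipart n D) = m" unfolding M1_bar_eq[OF n] by auto
    then have "(\<rho>, D) \<in> T" using cip[OF x(2)] by (simp add: T_def)
    then show "x \<in> f ` T" using x(1) by (force simp: f_def)
  next
    fix x assume "x \<in> f ` T"
    then obtain \<rho> D where x: "x = (ipart n D, \<rho>)" "(\<rho>, D) \<in> T" by (auto simp: f_def)
    then have "(\<rho>, D) \<in> cut_pairs n" "card D + card \<rho> = n" "card (ipart n D) = m"
      using cip[of \<rho> D] by (auto simp: T_def)
    then show "x \<in> {(\<pi>, \<rho>) \<in> M1_bar n. card \<pi> = m}"
      unfolding M1_bar_eq[OF n] using x(1) by force
  qed
  moreover have "inj_on f T"
  proof (rule inj_onI)
    fix x y assume xy: "x \<in> T" "y \<in> T" "f x = f y"
    obtain \<rho> D \<sigma> E where e: "x = (\<rho>, D)" "y = (\<sigma>, E)" by (metis surj_pair)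
    have "ipart n D = ipart n E" "\<rho> = \<sigma>" using xy(3) by (simp_all add: e f_def)
    moreover have "D \<in> Pow {1..<n}" "E \<in> Pow {1..<n}" using xy sub by (auto simp: e T_def)
    ultimately show "x = y" using inj_onD[OF ipart_inj] e by blast
  qed
  ultimately have "card {(\<pi>, \<rho>) \<in> M1_bar n. card \<pi> = m} = card T" by (simp add: card_image)
  moreover have "n * card T = (n choose (m - 1)) * ((n + (m - 1)) choose (2 * (m - 1) + 1))"
    unfolding T_def using n by (intro card_tight_cut_pairs) simp
  \<comment> \<open>The lower indices are complementary: \<open>2 * (m - 1) + 1\<close> and
    \<open>n - m\<close> add up to \<open>n + m - 1\<close>.\<close>
  moreover have "(n + (m - 1)) choose (2 * (m - 1) + 1) = (n + m - 1) choose (n - m)"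
  proof -
    have "n - m = (n + (m - 1)) - (2 * (m - 1) + 1)" "n + m - 1 = n + (m - 1)" using m by auto
    moreover have "2 * (m - 1) + 1 \<le> n + (m - 1)" using m by auto
    ultimately show ?thesis using binomial_symmetric by metis
  qed
  ultimately show ?thesis by simp
qed

theorem theorem1p1:
  fixes n :: nat
  assumes "n \<ge> 1"
  shows "real (card (M1_bar n)) =
           (\<Sum>m=1..n. 1 / real n * real (n choose (m - 1)) * real ((n + m - 1) choose (n - m)))
       \<and> (\<forall>m\<in>{1..n}.
            1 / real n * real (n choose (m - 1)) * real ((n + m - 1) choose (n - m)) =
            real (card {(\<pi>, \<rho>) \<in> M1_bar n. card \<pi> = m}))"
proof -
  let ?M = "\<lambda>m. {(\<pi>, \<rho>) \<in> M1_bar n. card \<pi> = m}"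
  have terms: "1 / real n * real (n choose (m - 1)) * real ((n + m - 1) choose (n - m)) = real (card (?M m))"
    if "m \<in> {1..n}" for m
  proof -
    have "real n * real (card (?M m)) = real (n choose (m - 1)) * real ((n + m - 1) choose (n - m))"
      using card_M1_bar_fixed[of m n] that unfolding of_nat_mult[symmetric] by simp
    then show ?thesis using assms by (simp add: field_simps)
  qed
  have fin: "finite (M1_bar n)"
    unfolding M1_bar_eq[OF assms]
    by (intro finite_imageI finite_subset[OF _ finite_cut_pairs[of n]]) auto
  have "M1_bar n = (\<Union>m\<in>{1..n}. ?M m)"
  proof (intro equalityI subsetI)
    fix x assume x: "x \<in> M1_bar n"
    then obtain \<rho> D where D: "x = (ipart n D, \<rho>)" "D \<subseteq> {1..<n}"
      unfolding M1_bar_eq[OF assms] by (auto simp: cut_pairs_def)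
    have "card D \<le> n - 1" using card_mono[OF _ D(2)] by simp
    then have "card (ipart n D) \<in> {1..n}" using card_ipart[OF assms D(2)] assms by simp
    then show "x \<in> (\<Union>m\<in>{1..n}. ?M m)" using x D(1) by blast
  qed auto
  then have "card (M1_bar n) = card (\<Union>m\<in>{1..n}. ?M m)" by simp
  also have "\<dots> = (\<Sum>m=1..n. card (?M m))"
    by (rule card_UN_disjoint) (auto intro: finite_subset[OF _ fin])
  finally show ?thesis using terms by simp
qed

end
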